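(* There is a uniformly almost everywhere dominating function $f\in\omega^\omega$ such that no infinite r.e. set $Y\subseteq\omega^{<\omega}$ is $\Sigma^0_1$-dense in $f$.
   Context: $\omega^{<\omega}$ is the set of finite strings of natural numbers. $\sigma\sqsubseteq\tau$ means that $\sigma$ is an initial segment of $\tau$ (not necessarily proper; $\tau$ may be a finite string or an infinite sequence), in which case $\tau$ is said to extend $\sigma$. $f\upharpoonright n$ is the initial segment of $f$ of length $n$. "r.e." means recursively enumerable, and $\leq_T$ is Turing reducibility. For $f,g\in\omega^\omega$, write $g\leq^* f$ if $(\exists n_0)(\forall n\geq n_0)\; g(n)\leq f(n)$. A function $f\in\omega^\omega$ is uniformly almost everywhere dominating if $$\mu\bigl(\{Z\in 2^\omega:(\forall g\in\omega^\omega)(g\leq_T Z\Rightarrow g\leq^* f)\}\bigr)=1,$$ where $\mu$ is the uniform (Lebesgue, fair-coin) measure on $2^\omega$. Let $f\in\omega^\omega$. A set $W\subseteq\omega^{<\omega}$ is dense in $f$ if $(\forall n)(\exists\sigma\in W)(f\upharpoonright n\sqsubseteq\sigma)$. An infinite r.e. set $Y\subseteq\omega^{<\omega}$ is $\Sigma^0_1$-dense in $f$ if (a) no member of $Y$ is an initial segment of $f$; and (b) for every r.e. set $W\subseteq\omega^{<\omega}$ which is dense in $f$, some member of $W$ extends some member of $Y$. *)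

theory Defs
  imports "HOL-Probability.Probability" "HOL-Library.Sublist" "HOL-Library.Nat_Bijection"
begin

section \<open>Computability relative to a function\<close>

text \<open>
  Kleene's schemes: zero, successor, projections, composition, primitive recursion and
  unbounded search, together with one extra initial function, the query to the given function.
\<close>

datatype program =
    Zero
  | Succ
  | Proj nat
  | Oracle
  | Compose program "program list"
  | Prim_Rec program program
  | Search program

text \<open>
  \<open>computes h e xs y\<close>: relative to \<open>h\<close>, program \<open>e\<close> halts on arguments \<open>xs\<close> with output \<open>y\<close>.
  Programs carry no arity: \<open>Zero\<close> serves every arity and \<open>Proj i\<close> every arity above \<open>i\<close>; where no
  rule applies, the program does not halt. In the rule for search, all values of the searched function below the least zero must be defined.
\<close>

inductive computes :: "(nat \<Rightarrow> nat) \<Rightarrow> program \<Rightarrow> nat list \<Rightarrow> nat \<Rightarrow> bool"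
  for h :: "nat \<Rightarrow> nat"
where
  zero: "computes h Zero xs 0"
| succ: "computes h Succ [x] (Suc x)"
| proj: "i < length xs \<Longrightarrow> computes h (Proj i) xs (xs ! i)"
| query: "computes h Oracle [x] (h x)"
| compose: "list_all2 (\<lambda>g y. computes h g xs y) gs ys \<Longrightarrow> computes h f ys z
    \<Longrightarrow> computes h (Compose f gs) xs z"
| prim_rec_0: "computes h f xs y \<Longrightarrow> computes h (Prim_Rec f g) (0 # xs) y"
| prim_rec_Suc: "computes h (Prim_Rec f g) (n # xs) y \<Longrightarrow> computes h g (n # y # xs) z
    \<Longrightarrow> computes h (Prim_Rec f g) (Suc n # xs) z"
| search: "computes h f (n # xs) 0 \<Longrightarrow> (\<And>m. m < n \<Longrightarrow> \<exists>k. computes h f (m # xs) (Suc k))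
    \<Longrightarrow> computes h (Search f) xs n"

definition turing_le :: "(nat \<Rightarrow> nat) \<Rightarrow> (nat \<Rightarrow> nat) \<Rightarrow> bool"  (infix "\<le>\<^sub>T" 50) where
  "g \<le>\<^sub>T h \<longleftrightarrow> (\<exists>e. \<forall>n. computes h e [n] (g n))"

fun oracle_free :: "program \<Rightarrow> bool" where
  "oracle_free Zero = True"
| "oracle_free Succ = True"
| "oracle_free (Proj i) = True"
| "oracle_free Oracle = False"
| "oracle_free (Compose f gs) = (oracle_free f \<and> (\<forall>g\<in>set gs. oracle_free g))"
| "oracle_free (Prim_Rec f g) = (oracle_free f \<and> oracle_free g)"
| "oracle_free (Search f) = oracle_free f"

text \<open>
  A set of numbers is r.e. if it is the domain of a partial recursive function. The
  function \<open>\<lambda>_. 0\<close> is a dummy: a program without \<^const>\<open>Oracle\<close> never consults it.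
\<close>

definition re_nat :: "nat set \<Rightarrow> bool" where
  "re_nat A \<longleftrightarrow> (\<exists>e. oracle_free e \<and> A = {n. \<exists>y. computes (\<lambda>_. 0) e [n] y})"

text \<open>Sets of strings are handled through the computable bijection \<^const>\<open>list_encode\<close>.\<close>

definition re :: "nat list set \<Rightarrow> bool" where
  "re W \<longleftrightarrow> re_nat (list_encode ` W)"

section \<open>Uniformly almost everywhere dominating functions\<close>

definition cantor_measure :: "(nat \<Rightarrow> bool) measure" where
  "cantor_measure = Pi\<^sub>M UNIV (\<lambda>_. measure_pmf (bernoulli_pmf (1 / 2)))"

definition char_fun :: "(nat \<Rightarrow> bool) \<Rightarrow> nat \<Rightarrow> nat" where
  "char_fun Z n = (if Z n then 1 else 0)"

definition le_star :: "(nat \<Rightarrow> nat) \<Rightarrow> (nat \<Rightarrow> nat) \<Rightarrow> bool"  (infix "\<le>\<^sup>*" 50) where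
  "g \<le>\<^sup>* f \<longleftrightarrow> (\<exists>n0. \<forall>n\<ge>n0. g n \<le> f n)"

text \<open>
  Since \<^const>\<open>measure\<close> is \<open>0\<close> on non-measurable sets, the condition below includes
  measurability of the set in question.
\<close>

definition uniformly_ae_dominating :: "(nat \<Rightarrow> nat) \<Rightarrow> bool" where
  "uniformly_ae_dominating f \<longleftrightarrow>
     measure cantor_measure {Z. \<forall>g. g \<le>\<^sub>T char_fun Z \<longrightarrow> g \<le>\<^sup>* f} = 1"

section \<open>Density of sets of strings\<close>

definition restrict_to :: "(nat \<Rightarrow> nat) \<Rightarrow> nat \<Rightarrow> nat list"  (infix "\<restriction>" 75) where
  "f \<restriction> n = map f [0..<n]"

definition initial_segment :: "nat list \<Rightarrow> (nat \<Rightarrow> nat) \<Rightarrow> bool" where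
  "initial_segment \<sigma> f \<longleftrightarrow> (\<exists>n. \<sigma> = f \<restriction> n)"

definition dense_in :: "nat list set \<Rightarrow> (nat \<Rightarrow> nat) \<Rightarrow> bool" where
  "dense_in W f \<longleftrightarrow> (\<forall>n. \<exists>\<sigma>\<in>W. prefix (f \<restriction> n) \<sigma>)"

text \<open>The notion is meant for infinite r.e. sets \<open>Y\<close>; these two hypotheses are kept separate.\<close>

definition sigma1_dense_in :: "nat list set \<Rightarrow> (nat \<Rightarrow> nat) \<Rightarrow> bool" where
  "sigma1_dense_in Y f \<longleftrightarrow>
     (\<forall>\<sigma>\<in>Y. \<not> initial_segment \<sigma> f) \<and>
     (\<forall>W. re W \<and> dense_in W f \<longrightarrow> (\<exists>\<tau>\<in>W. \<exists>\<sigma>\<in>Y. prefix \<sigma> \<tau>))"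

end

theory Submission imports Defs begin

text \<open>
  The function \<open>f\<close> is built by forcing with pairs of a string \<open>\<sigma>\<close> and finitely many promises
  \<open>(e, N, q)\<close>: more than measure \<open>q\<close> of the oracles \<open>Z\<close> for which program \<open>e\<close> is total satisfy
  \<open>\<Phi>\<^sub>e\<^sup>Z(n) \<le> f(n)\<close> for all \<open>n \<ge> N\<close>. Promising this for every \<open>e\<close> and every \<open>q\<close> below the measure of the
  total oracles makes \<open>f\<close> uniformly almost everywhere dominating.

  Given \<open>Y\<close>, either some \<open>y \<in> Y\<close> is a prefix of \<open>\<sigma>\<close>, or extends \<open>\<sigma>\<close> and respects the promises, and
  \<open>f\<close> can be made to extend it; or there is no such \<open>y\<close>. In the second case raise the bounds \<open>q\<close> to
  rationals \<open>q' > q\<close> and lengthen \<open>\<sigma>\<close> until the oracles on which \<open>e\<close> is defined on \<open>{..<|\<sigma>|}\<close> without being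
  total have measure less than \<open>q' - q\<close>. Then totality may be dropped from the promises with bound \<open>q'\<close>:
  measured over all oracles, they define an r.e. set of strings \<open>\<tau>\<close> that is dense in every \<open>f\<close> keeping them, while
  each such \<open>\<tau>\<close> respects the old promises, so that no member of \<open>Y\<close> is below it.
\<close>

section \<open>Step-bounded evaluation\<close>

text \<open>
  The result \<open>0\<close> means that no value was found, and \<open>Suc y\<close> that the output is \<open>y\<close>; the bound \<open>s\<close>
  limits both the queries and the searches.
\<close>

fun run :: "nat \<Rightarrow> (nat \<Rightarrow> nat) \<Rightarrow> program \<Rightarrow> nat list \<Rightarrow> nat" where
  "run s h Zero xs = 1"
| "run s h Succ xs = (if length xs = 1 then Suc (Suc (xs ! 0)) else 0)"
| "run s h (Proj i) xs = (if i < length xs then Suc (xs ! i) else 0)"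
| "run s h Oracle xs = (if length xs = 1 \<and> xs ! 0 < s then Suc (h (xs ! 0)) else 0)"
| "run s h (Compose f gs) xs =
     (if \<forall>g\<in>set gs. run s h g xs \<noteq> 0 then run s h f (map (\<lambda>g. run s h g xs - 1) gs) else 0)"
| "run s h (Prim_Rec f g) xs = (case xs of [] \<Rightarrow> 0 | n # xs \<Rightarrow>
     rec_nat (run s h f xs) (\<lambda>m r. if r = 0 then 0 else run s h g (m # (r - 1) # xs)) n)"
| "run s h (Search f) xs =
     (\<Sum>n<s. if run s h f (n # xs) = 1 \<and> (\<forall>m<n. 1 < run s h f (m # xs)) then Suc n else 0)"

text \<open>Under the shifted coding \<open>1\<close> is the output zero and values above
  \<open>1\<close> are positive outputs. Only one index can be a first zero, so the sum has at most
  one nonzero summand.\<close>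

lemma bounded_search_eq_Suc_iff:
  fixes F :: "nat \<Rightarrow> nat"
  shows "(\<Sum>n<s. if F n = 1 \<and> (\<forall>m<n. 1 < F m) then Suc n else 0) = Suc y \<longleftrightarrow>
    y < s \<and> F y = 1 \<and> (\<forall>m<y. 1 < F m)" (is "?S = _ \<longleftrightarrow> _")
proof -
  let ?P = "\<lambda>n. F n = 1 \<and> (\<forall>m<n. 1 < F m)"
  have eq: "?S = Suc n" if "n < s" "?P n" for n
  proof -
    have "?P k \<longleftrightarrow> k = n" for k
      using that(2) by (metis less_irrefl linorder_neqE_nat)
    then have "?S = (\<Sum>k<s. if k = n then Suc k else 0)"
      by (intro sum.cong) auto
    then show ?thesis
      using that(1) by simp
  qed
  have "\<exists>n<s. ?P n" if "?S = Suc y"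
  proof (rule ccontr)
    assume "\<not> ?thesis"
    then have "?S = 0"
      by (auto intro!: sum.neutral)
    then show False
      using that by simp
  qed
  then show ?thesis
    using eq by auto
qed

text \<open>A use principle: with bound \<open>s\<close> only oracle values below \<open>s\<close>
  are consulted, so a value once found persists under larger bounds and under changes of the oracle
  from \<open>s\<close> on.\<close>

lemma run_mono:
  "run s h e xs = Suc y \<Longrightarrow> s \<le> s' \<Longrightarrow> (\<And>i. i < s \<Longrightarrow> h' i = h i) \<Longrightarrow> run s' h' e xs = Suc y"
proof (induction e arbitrary: xs y)
  case (Compose f gs)
  have nz: "\<forall>g\<in>set gs. run s h g xs \<noteq> 0"
    using Compose.prems(1) by (auto split: if_splits)
  then have "run s' h' g xs = run s h g xs" if "g \<in> set gs" for g
    using Compose.IH(2)[OF that _ Compose.prems(2,3)] that by (metis not0_implies_Suc)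
  then have "map (\<lambda>g. run s' h' g xs - 1) gs = map (\<lambda>g. run s h g xs - 1) gs"
    "\<forall>g\<in>set gs. run s' h' g xs \<noteq> 0"
    using nz by auto
  moreover have "run s' h' f (map (\<lambda>g. run s h g xs - 1) gs) = Suc y"
    using Compose.IH(1)[OF _ Compose.prems(2,3)] Compose.prems(1) nz by simp
  ultimately show ?case
    by (simp only: run.simps) simp
next
  case (Prim_Rec f g)
  obtain n zs where xs: "xs = n # zs"
    using Prim_Rec.prems by (cases xs) auto
  let ?R = "\<lambda>s h n. rec_nat (run s h f zs) (\<lambda>m r. if r = 0 then 0 else run s h g (m # (r - 1) # zs)) n"
  have "?R s h n = Suc y \<Longrightarrow> ?R s' h' n = Suc y"
  proof (induction n arbitrary: y)
    case 0
    then show ?case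
      using Prim_Rec.IH(1)[OF _ Prim_Rec.prems(2,3)] by simp
  next
    case (Suc n)
    then obtain z where z: "?R s h n = Suc z"
      by (cases "?R s h n") auto
    then show ?case
      using Suc.IH[OF z] Suc.prems Prim_Rec.IH(2)[OF _ Prim_Rec.prems(2,3)] by simp
  qed
  then show ?case
    using Prim_Rec.prems(1) xs by simp
next
  case (Search f)
  have keep: "run s' h' f zs = run s h f zs" if "run s h f zs \<noteq> 0" for zs
    using Search.IH[OF _ Search.prems(2,3)] that by (metis not0_implies_Suc)
  have "y < s \<and> run s h f (y # xs) = 1 \<and> (\<forall>m<y. 1 < run s h f (m # xs))"
    using Search.prems(1) unfolding run.simps bounded_search_eq_Suc_iff .
  moreover from this have "run s' h' f (m # xs) = run s h f (m # xs)" if "m \<le> y" for m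
    using that by (intro keep) (auto simp: le_less)
  ultimately show ?case
    using Search.prems(2) unfolding run.simps bounded_search_eq_Suc_iff by auto
qed (auto split: if_splits)

text \<open>The result \<open>0\<close> is covered too: by \<open>run_mono\<close> in both
  directions, neither side can find a value that the other misses.\<close>

lemma run_cong: "(\<And>i. i < s \<Longrightarrow> h i = h' i) \<Longrightarrow> run s h e xs = run s h' e xs"
  using run_mono[of s h e xs _ s h'] run_mono[of s h' e xs _ s h] by (metis not0_implies_Suc order_refl)

lemma computes_if_run: "run s h e xs = Suc y \<Longrightarrow> computes h e xs y"
proof (induction e arbitrary: xs y)
  case Succ
  then show ?case
    by (cases xs) (auto split: if_splits intro: computes.intros)
next
  case Oracle
  then show ?case
    by (cases xs) (auto split: if_splits intro: computes.intros)
next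
  case (Compose f gs)
  let ?ys = "map (\<lambda>g. run s h g xs - 1) gs"
  have nz: "\<forall>g\<in>set gs. run s h g xs \<noteq> 0"
    using Compose.prems(1) by (auto split: if_splits)
  then have "list_all2 (\<lambda>g y. computes h g xs y) gs ?ys"
    using Compose.IH(2) by (auto simp: list_all2_conv_all_nth)
  then show ?case
    using Compose.IH(1)[of ?ys y] Compose.prems nz by (auto intro: computes.compose)
next
  case (Prim_Rec f g)
  obtain n zs where xs: "xs = n # zs"
    using Prim_Rec.prems by (cases xs) auto
  let ?R = "\<lambda>n. rec_nat (run s h f zs) (\<lambda>m r. if r = 0 then 0 else run s h g (m # (r - 1) # zs)) n"
  have "?R n = Suc y \<Longrightarrow> computes h (Prim_Rec f g) (n # zs) y"
  proof (induction n arbitrary: y)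
    case 0
    then show ?case
      using Prim_Rec.IH(1) by (auto intro: computes.intros)
  next
    case (Suc n)
    then obtain z where z: "?R n = Suc z"
      by (cases "?R n") auto
    then show ?case
      using Suc.IH[OF z] Suc.prems Prim_Rec.IH(2) by (auto intro: computes.intros)
  qed
  then show ?case
    using Prim_Rec.prems(1) xs by simp
next
  case (Search f)
  have y: "run s h f (y # xs) = 1" "\<And>m. m < y \<Longrightarrow> 1 < run s h f (m # xs)"
    using Search.prems(1) unfolding run.simps bounded_search_eq_Suc_iff by blast+
  show ?case
  proof (rule computes.search)
    show "computes h f (y # xs) 0"
      using y(1) Search.IH by simp
    show "\<exists>k. computes h f (m # xs) (Suc k)" if "m < y" for m
      using Search.IH[of "m # xs" "run s h f (m # xs) - 1"] y(2)[OF that]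
      \<comment> \<open>One unit is removed for the shifted coding of \<open>run\<close> and one for
        the \<open>Suc\<close> in the search rule.\<close>
      by (intro exI[of _ "run s h f (m # xs) - 2"]) (simp add: Suc_diff_Suc numeral_2_eq_2)
  qed
qed (auto split: if_splits intro: computes.intros)

text \<open>A derivation rests on finitely many subcomputations; the eventual form lets their bounds
  be combined.\<close>

lemma eventually_run_if_computes:
  "computes h e xs y \<Longrightarrow> eventually (\<lambda>s. run s h e xs = Suc y) sequentially"
proof (induction rule: computes.induct)
  case (query x)
  then show ?case
    using eventually_gt_at_top[of x] by eventually_elim simp
next
  case (compose xs gs ys f z)
  have len: "length ys = length gs"
    using compose.IH(1) by (auto simp: list_all2_lengthD)
  have "eventually (\<lambda>s. \<forall>i\<in>{..<length gs}. run s h (gs ! i) xs = Suc (ys ! i)) sequentially"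
    using compose.IH(1) by (intro eventually_ball_finite) (auto simp: list_all2_conv_all_nth)
  then show ?case
    using compose.IH(2)
  proof eventually_elim
    case (elim s)
    have "map (\<lambda>g. run s h g xs - 1) gs = ys"
      using elim(1) len by (intro nth_equalityI) auto
    moreover have "\<forall>g\<in>set gs. run s h g xs \<noteq> 0"
      using elim(1) by (auto simp: in_set_conv_nth)
    ultimately show ?case
      using elim(2) by simp
  qed
next
  case (prim_rec_Suc f g n xs y z)
  from prim_rec_Suc.IH show ?case
    by eventually_elim simp
next
  case (search f n xs)
  have "eventually (\<lambda>s. \<forall>m\<in>{..<n}. 1 < run s h f (m # xs)) sequentially"
  proof (rule eventually_ball_finite)
    show "\<forall>m\<in>{..<n}. eventually (\<lambda>s. 1 < run s h f (m # xs)) sequentially"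
      using search.IH(2) by (force elim: eventually_mono)
  qed simp
  then show ?case
    using search.IH(1) eventually_gt_at_top[of n]
  proof eventually_elim
    case (elim s)
    then show ?case
      unfolding run.simps bounded_search_eq_Suc_iff by simp
  qed
qed simp_all

text \<open>At a bound large enough for both derivations, the function \<open>run\<close> returns a
  single value.\<close>

lemma computes_deterministic:
  assumes "computes h e xs y" "computes h e xs z"
  shows "y = z"
proof -
  have "eventually (\<lambda>s. run s h e xs = Suc y \<and> run s h e xs = Suc z) sequentially"
    using assms by (intro eventually_conj eventually_run_if_computes)
  then show ?thesis
    by (auto simp: eventually_sequentially)
qed

section \<open>A calculus of recursive functions\<close>

text \<open>The arity is recorded here because programs carry none; on lists of other lengths
  \<open>F\<close> is unconstrained.\<close>

definition recf :: "nat \<Rightarrow> (nat list \<Rightarrow> nat) \<Rightarrow> bool" where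
  "recf k F \<longleftrightarrow> (\<exists>p. oracle_free p \<and> (\<forall>xs. length xs = k \<longrightarrow> computes (\<lambda>_. 0) p xs (F xs)))"

named_theorems recf_intros

lemma recf_cong:
  assumes "recf k F" "\<And>xs. length xs = k \<Longrightarrow> F xs = G xs"
  shows "recf k G"
  using assms unfolding recf_def by metis

lemma recf_nth [recf_intros]: "i < k \<Longrightarrow> recf k (\<lambda>xs. xs ! i)"
  unfolding recf_def by (intro exI[of _ "Proj i"]) (auto intro: computes.intros)

lemma recf_compose:
  assumes G: "recf (length Fs) G" and Fs: "\<And>F. F \<in> set Fs \<Longrightarrow> recf k F"
  shows "recf k (\<lambda>xs. G (map (\<lambda>F. F xs) Fs))"
proof -
  obtain p where p: "oracle_free p" "\<And>xs. length xs = length Fs \<Longrightarrow> computes (\<lambda>_. 0) p xs (G xs)"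
    using G unfolding recf_def by blast
  obtain q where q: "\<And>F. F \<in> set Fs \<Longrightarrow> oracle_free (q F)"
    "\<And>F xs. F \<in> set Fs \<Longrightarrow> length xs = k \<Longrightarrow> computes (\<lambda>_. 0) (q F) xs (F xs)"
    using Fs unfolding recf_def by metis
  have "computes (\<lambda>_. 0) (Compose p (map q Fs)) xs (G (map (\<lambda>F. F xs) Fs))" if "length xs = k" for xs
    using p(2)[of "map (\<lambda>F. F xs) Fs"] q(2) that
    by (intro computes.compose[where ys = "map (\<lambda>F. F xs) Fs"]) (auto simp: list_all2_conv_all_nth)
  then show ?thesis
    using p(1) q(1) unfolding recf_def by (intro exI[of _ "Compose p (map q Fs)"]) auto
qed

lemma recf_compose1: "recf 1 (\<lambda>xs. g (xs ! 0)) \<Longrightarrow> recf k F \<Longrightarrow> recf k (\<lambda>xs. g (F xs))"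
  using recf_compose[of "[F]" "\<lambda>xs. g (xs ! 0)" k] by simp

lemma recf_compose2:
  "recf 2 (\<lambda>xs. g (xs ! 0) (xs ! 1)) \<Longrightarrow> recf k F \<Longrightarrow> recf k G \<Longrightarrow> recf k (\<lambda>xs. g (F xs) (G xs))"
  using recf_compose[of "[F, G]" "\<lambda>xs. g (xs ! 0) (xs ! 1)" k] by (auto simp: numeral_2_eq_2)

lemma recf_Suc [recf_intros]: "recf k F \<Longrightarrow> recf k (\<lambda>xs. Suc (F xs))"
proof (rule recf_compose1[of Suc])
  have "computes (\<lambda>_. 0) Succ xs (Suc (xs ! 0))" if "length xs = 1" for xs
    using that by (cases xs) (auto intro: computes.succ)
  then show "recf 1 (\<lambda>xs. Suc (xs ! 0))"
    unfolding recf_def by (intro exI[of _ Succ]) auto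
qed

lemma recf_const [recf_intros]: "recf k (\<lambda>_. c)"
proof (induction c)
  case 0
  show ?case
    unfolding recf_def by (intro exI[of _ Zero]) (auto intro: computes.zero)
qed (rule recf_Suc)

lemma recf_drop: "recf k F \<Longrightarrow> recf (j + k) (\<lambda>xs. F (drop j xs))"
proof -
  assume "recf k F"
  then have "recf (j + k) (\<lambda>xs. F (map (\<lambda>G. G xs) (map (\<lambda>i xs. xs ! (j + i)) [0..<k])))"
    by (intro recf_compose) (auto intro!: recf_nth)
  then show ?thesis
    by (rule recf_cong) (auto intro!: arg_cong[of _ _ F] nth_equalityI simp: o_def)
qed

lemma recf_hd [recf_intros]: "recf (Suc k) hd"
  by (rule recf_cong[OF recf_nth[of 0]]) (auto simp: hd_conv_nth length_Suc_conv)

lemma recf_tl: "recf k F \<Longrightarrow> recf (Suc k) (\<lambda>xs. F (tl xs))"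
  using recf_drop[of k F 1] by (simp add: drop_Suc)

lemma recf_rec_nat [recf_intros]:
  assumes A: "recf k A" and B: "recf (Suc (Suc k)) (\<lambda>ys. B (hd ys) (hd (tl ys)) (tl (tl ys)))"
    and N: "recf k N"
  shows "recf k (\<lambda>xs. rec_nat (A xs) (\<lambda>m r. B m r xs) (N xs))"
proof -
  obtain a where a: "oracle_free a" "\<And>xs. length xs = k \<Longrightarrow> computes (\<lambda>_. 0) a xs (A xs)"
    using A unfolding recf_def by blast
  obtain b where b: "oracle_free b"
    "\<And>ys. length ys = Suc (Suc k) \<Longrightarrow> computes (\<lambda>_. 0) b ys (B (hd ys) (hd (tl ys)) (tl (tl ys)))"
    using B unfolding recf_def by blast
  have comp: "computes (\<lambda>_. 0) (Prim_Rec a b) (n # xs) (rec_nat (A xs) (\<lambda>m r. B m r xs) n)"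
    if "length xs = k" for n xs
  proof (induction n)
    case 0
    then show ?case
      using a(2)[OF that] by (auto intro: computes.intros)
  next
    case (Suc n)
    then show ?case
      using b(2)[of "n # rec_nat (A xs) (\<lambda>m r. B m r xs) n # xs"] that
      by (auto intro: computes.intros)
  qed
  have "computes (\<lambda>_. 0) (Prim_Rec a b) ys (rec_nat (A (tl ys)) (\<lambda>m r. B m r (tl ys)) (hd ys))"
    if "length ys = Suc k" for ys
    using comp[of "tl ys" "hd ys"] that by (cases ys) auto
  then have R: "recf (Suc k) (\<lambda>ys. rec_nat (A (tl ys)) (\<lambda>m r. B m r (tl ys)) (hd ys))"
    using a(1) b(1) unfolding recf_def by (intro exI[of _ "Prim_Rec a b"]) auto
  \<comment> \<open>\<open>Prim_Rec\<close> recurs on its first argument; \<open>N\<close> is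
    substituted there, and projections return the original arguments.\<close>
  have "recf k (\<lambda>xs. (\<lambda>ys. rec_nat (A (tl ys)) (\<lambda>m r. B m r (tl ys)) (hd ys))
     (map (\<lambda>F. F xs) (N # map (\<lambda>i xs. xs ! i) [0..<k])))"
    by (intro recf_compose) (auto intro: recf_nth N R)
  then show ?thesis
    by (rule recf_cong) (auto simp: o_def map_nth)
qed

text \<open>The binders of iterated operations push their variable in front of the argument list.\<close>

lemma recf_nth_tl [recf_intros]: "Suc i < k \<Longrightarrow> recf k (\<lambda>xs. tl xs ! i)"
  by (rule recf_cong[OF recf_nth[of "Suc i"]]) (auto simp: nth_tl)

lemma recf_nth_tl_tl [recf_intros]: "Suc (Suc i) < k \<Longrightarrow> recf k (\<lambda>xs. tl (tl xs) ! i)"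
  by (rule recf_cong[OF recf_nth[of "Suc (Suc i)"]]) (auto simp: nth_tl)

lemma recf_nth_tl_tl_tl [recf_intros]: "Suc (Suc (Suc i)) < k \<Longrightarrow> recf k (\<lambda>xs. tl (tl (tl xs)) ! i)"
  by (rule recf_cong[OF recf_nth[of "Suc (Suc (Suc i))"]]) (auto simp: nth_tl)

lemma recf_hd_tl [recf_intros]: "recf (Suc (Suc k)) (\<lambda>xs. hd (tl xs))"
  by (rule recf_tl) (rule recf_hd)

lemma recf_hd_tl_tl [recf_intros]: "recf (Suc (Suc (Suc k))) (\<lambda>xs. hd (tl (tl xs)))"
  by (rule recf_tl) (rule recf_hd_tl)

section \<open>Arithmetic functions and bounded sums\<close>

lemma recf_add [recf_intros]: "recf k F \<Longrightarrow> recf k G \<Longrightarrow> recf k (\<lambda>xs. F xs + G xs)"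
proof (rule recf_compose2[of "(+)"])
  have "recf 2 (\<lambda>xs. rec_nat (xs ! 0) (\<lambda>m r. Suc r) (xs ! 1))"
    by (intro recf_intros) auto
  moreover have "rec_nat a (\<lambda>m r. Suc r) b = a + b" for a b
    by (induction b) auto
  ultimately show "recf 2 (\<lambda>xs. xs ! 0 + xs ! 1)"
    by simp
qed

lemma recf_sum [recf_intros]:
  assumes "recf (Suc k) (\<lambda>ys. F (hd ys) (tl ys))" "recf k N"
  shows "recf k (\<lambda>xs. \<Sum>i<N xs. F i xs)"
proof -
  \<comment> \<open>The step of the recursion also receives the accumulator, at position 1;
    projections skip it.\<close>
  have "recf (Suc (Suc k)) (\<lambda>xs. F (hd xs) (tl (tl xs)))"
  proof -
    have "recf (Suc (Suc k)) (\<lambda>xs. (\<lambda>ys. F (hd ys) (tl ys))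
      (map (\<lambda>G. G xs) (map (\<lambda>i xs. xs ! (if i = 0 then 0 else Suc i)) [0..<Suc k])))"
      by (rule recf_compose) (use assms(1) in \<open>auto intro!: recf_nth\<close>)
    then show ?thesis
    proof (rule recf_cong)
      fix xs :: "nat list" assume "length xs = Suc (Suc k)"
      then have "map (\<lambda>G. G xs) (map (\<lambda>i xs. xs ! (if i = 0 then 0 else Suc i)) [0..<Suc k]) = hd xs # tl (tl xs)"
        by (intro nth_equalityI)
          (auto simp: nth_Cons nth_tl length_Suc_conv simp del: upt_Suc split: nat.splits)
      then show "(\<lambda>ys. F (hd ys) (tl ys))
        (map (\<lambda>G. G xs) (map (\<lambda>i xs. xs ! (if i = 0 then 0 else Suc i)) [0..<Suc k])) = F (hd xs) (tl (tl xs))"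
        by simp
    qed
  qed
  then have "recf k (\<lambda>xs. rec_nat 0 (\<lambda>i r. r + F i xs) (N xs))"
    by (intro recf_intros assms(2))
  moreover have "rec_nat 0 (\<lambda>i r. r + F i xs) n = (\<Sum>i<n. F i xs)" for n xs
    by (induction n) auto
  ultimately show ?thesis
    by simp
qed

lemma recf_mult [recf_intros]: "recf k F \<Longrightarrow> recf k G \<Longrightarrow> recf k (\<lambda>xs. F xs * G xs)"
proof (rule recf_compose2[of "(*)"])
  have "recf 2 (\<lambda>xs. \<Sum>i<xs ! 1. xs ! 0)"
    by (intro recf_intros) auto
  then show "recf 2 (\<lambda>xs. xs ! 0 * xs ! 1)"
    by (simp add: mult.commute)
qed

lemma recf_pow2 [recf_intros]: "recf k F \<Longrightarrow> recf k (\<lambda>xs. 2 ^ F xs)"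
proof (rule recf_compose1[of "\<lambda>x. 2 ^ x"])
  have "recf 1 (\<lambda>xs. rec_nat 1 (\<lambda>m r. r + r) (xs ! 0))"
    by (intro recf_intros) auto
  moreover have "rec_nat 1 (\<lambda>m r. r + r) n = (2::nat) ^ n" for n
    by (induction n) auto
  ultimately show "recf 1 (\<lambda>xs. 2 ^ xs ! 0)"
    by simp
qed

lemma recf_diff [recf_intros]: "recf k F \<Longrightarrow> recf k G \<Longrightarrow> recf k (\<lambda>xs. F xs - G xs)"
proof (rule recf_compose2[of "(-)"])
  \<comment> \<open>The predecessor comes from a recursion that returns its counter; subtraction
    iterates it.\<close>
  have "recf 1 (\<lambda>xs. rec_nat 0 (\<lambda>m r. m) (xs ! 0))"
    by (intro recf_intros) auto
  moreover have "rec_nat 0 (\<lambda>m r. m) n = n - 1" for n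
    by (cases n) auto
  ultimately have pred: "recf 1 (\<lambda>xs. xs ! 0 - 1)"
    by simp
  have "recf 2 (\<lambda>xs. rec_nat (xs ! 0) (\<lambda>m r. r - 1) (xs ! 1))"
    by (intro recf_intros recf_compose1[OF pred]) auto
  moreover have "rec_nat a (\<lambda>m r. r - 1) n = a - n" for a n
    by (induction n) auto
  ultimately show "recf 2 (\<lambda>xs. xs ! 0 - xs ! 1)"
    by simp
qed

section \<open>Recursive predicates and bounded quantification\<close>

definition recp :: "nat \<Rightarrow> (nat list \<Rightarrow> bool) \<Rightarrow> bool" where
  "recp k P \<longleftrightarrow> recf k (\<lambda>xs. of_bool (P xs))"

lemma recf_of_bool [recf_intros]: "recp k P \<Longrightarrow> recf k (\<lambda>xs. of_bool (P xs))"
  by (simp add: recp_def)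

lemma recp_cong:
  assumes "recp k P" "\<And>xs. length xs = k \<Longrightarrow> P xs = Q xs"
  shows "recp k Q"
  using assms(1) unfolding recp_def by (rule recf_cong) (simp add: assms(2))

lemma recf_if [recf_intros]:
  assumes "recp k P" "recf k F" "recf k G"
  shows "recf k (\<lambda>xs. if P xs then F xs else G xs)"
proof -
  have "recf k (\<lambda>xs. of_bool (P xs) * F xs + (1 - of_bool (P xs)) * G xs)"
    by (intro recf_intros assms)
  then show ?thesis
    by (rule recf_cong) auto
qed

lemma recp_le [recf_intros]:
  assumes "recf k F" "recf k G"
  shows "recp k (\<lambda>xs. F xs \<le> G xs)"
proof -
  have "recf k (\<lambda>xs. 1 - (F xs - G xs))"
    by (intro recf_intros assms)
  then show ?thesis
    unfolding recp_def by (rule recf_cong) auto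
qed

lemma recp_not [recf_intros]: "recp k P \<Longrightarrow> recp k (\<lambda>xs. \<not> P xs)"
  unfolding recp_def by (rule recf_cong[OF recf_diff[OF recf_const[of _ 1]]]) auto

lemma recp_conj [recf_intros]: "recp k P \<Longrightarrow> recp k Q \<Longrightarrow> recp k (\<lambda>xs. P xs \<and> Q xs)"
  unfolding recp_def of_bool_conj by (rule recf_mult)

lemma recp_disj [recf_intros]: "recp k P \<Longrightarrow> recp k Q \<Longrightarrow> recp k (\<lambda>xs. P xs \<or> Q xs)"
  using recp_not[OF recp_conj[OF recp_not[of k P] recp_not[of k Q]]] by simp

lemma recp_less [recf_intros]: "recf k F \<Longrightarrow> recf k G \<Longrightarrow> recp k (\<lambda>xs. F xs < G xs)"
  using recp_not[OF recp_le[of k G F]] by (simp add: not_le)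

lemma recp_eq [recf_intros]: "recf k F \<Longrightarrow> recf k G \<Longrightarrow> recp k (\<lambda>xs. F xs = G xs)"
  using recp_conj[OF recp_le[of k F G] recp_le[of k G F]] by (simp add: eq_iff)

lemma recp_all [recf_intros]:
  assumes "recp (Suc k) (\<lambda>ys. P (hd ys) (tl ys))" "recf k N"
  shows "recp k (\<lambda>xs. \<forall>i<N xs. P i xs)"
proof -
  \<comment> \<open>The bounded quantifier holds when the number of counterexamples is zero.\<close>
  have "recp k (\<lambda>xs. (\<Sum>i<N xs. of_bool (\<not> P i xs)) = (0::nat))"
    by (intro recf_intros assms)
  then show ?thesis
    by (rule recp_cong) auto
qed

text \<open>The quotient counts the positive multiples of the divisor that do not exceed the
  dividend; since the divisor is positive, all of them fall within the range of the sum.\<close>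

lemma recf_div [recf_intros]:
  assumes "recf k F" "recf k G" "\<And>xs. length xs = k \<Longrightarrow> 0 < G xs"
  shows "recf k (\<lambda>xs. F xs div G xs)"
proof -
  have "recf 2 (\<lambda>ys. \<Sum>i<ys ! 0. of_bool (Suc i * ys ! 1 \<le> ys ! 0))"
    by (intro recf_intros) auto
  then have "recf k (\<lambda>xs. \<Sum>i<F xs. of_bool (Suc i * G xs \<le> F xs))"
    by (rule recf_compose2) fact+
  then show ?thesis
  proof (rule recf_cong)
    fix xs :: "nat list" assume "length xs = k"
    then have pos: "0 < G xs"
      by (rule assms(3))
    have "(\<Sum>i<F xs. of_bool (Suc i * G xs \<le> F xs)) = card ({..<F xs} \<inter> {i. Suc i * G xs \<le> F xs})"
      by (simp add: of_bool_def sum.If_cases)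
    also have "Suc i * G xs \<le> F xs \<longleftrightarrow> i < F xs div G xs" for i
      unfolding less_eq_div_iff_mult_less_eq[OF pos, symmetric] Suc_le_eq ..
    then have "{..<F xs} \<inter> {i. Suc i * G xs \<le> F xs} = {..<F xs div G xs}"
      by (auto intro: order.strict_trans2)
    finally show "(\<Sum>i<F xs. of_bool (Suc i * G xs \<le> F xs)) = F xs div G xs"
      by simp
  qed
qed

lemma recp_bit [recf_intros]:
  assumes "recf k F" "recf k G"
  shows "recp k (\<lambda>xs. bit (F xs) (G xs))"
proof -
  \<comment> \<open>Oddness of the shifted number, expressed with division and equality
    only.\<close>
  have "recp k (\<lambda>xs. F xs div 2 ^ G xs = Suc (2 * (F xs div 2 ^ G xs div 2)))"
    by (intro recf_intros assms) auto
  moreover have "q = Suc (2 * (q div 2)) \<longleftrightarrow> odd q" for q :: nat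
    by presburger
  ultimately show ?thesis
    by (simp add: bit_iff_odd)
qed

section \<open>Recursiveness of step-bounded evaluation\<close>

lemma recf_run_compose:
  assumes run: "recf (Suc (Suc k)) (\<lambda>xs. run (hd xs) (char_fun (bit (hd (tl xs)))) e (tl (tl xs)))"
    and S: "recf m S" and C: "recf m C"
    and L: "\<And>xs. length xs = m \<Longrightarrow> length (L xs) = k" "\<And>i. i < k \<Longrightarrow> recf m (\<lambda>xs. L xs ! i)"
  shows "recf m (\<lambda>xs. run (S xs) (char_fun (bit (C xs))) e (L xs))"
proof -
  have "recf m (\<lambda>xs. (\<lambda>ys. run (hd ys) (char_fun (bit (hd (tl ys)))) e (tl (tl ys)))
    (map (\<lambda>F. F xs) (S # C # map (\<lambda>i xs. L xs ! i) [0..<k])))"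
    by (rule recf_compose) (use assms in auto)
  moreover have "map (\<lambda>i. L xs ! i) [0..<k] = L xs" if "length xs = m" for xs
    using L(1)[OF that] by (metis map_nth)
  ultimately show ?thesis
    by (elim recf_cong) (simp add: o_def)
qed

lemma recp_Ball_list: "(\<And>g. g \<in> set gs \<Longrightarrow> recp k (P g)) \<Longrightarrow> recp k (\<lambda>xs. \<forall>g\<in>set gs. P g xs)"
proof (induction gs)
  case Nil
  then show ?case
    using recp_le[OF recf_const[of k 0] recf_const[of k 0]] by simp
next
  case (Cons g gs)
  then show ?case
    using recp_conj[of k "P g" "\<lambda>xs. \<forall>g\<in>set gs. P g xs"] by simp
qed

text \<open>Induction on the fixed program: each clause of \<open>run\<close> is an expression of
  the calculus in the bound, the oracle code and the arguments, in this order. The binary digits of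
  the code serve as a finite oracle.\<close>

lemma recf_run_env:
  "recf (Suc (Suc k)) (\<lambda>xs. run (hd xs) (char_fun (bit (hd (tl xs)))) e (tl (tl xs)))"
proof (induction e arbitrary: k)
  case Zero
  show ?case
    unfolding run.simps by (rule recf_const)
next
  case Succ
  show ?case
  proof (cases "k = 1")
    case True
    then have "recf (Suc (Suc k)) (\<lambda>xs. Suc (Suc (tl (tl xs) ! 0)))"
      by (intro recf_intros) auto
    then show ?thesis
      by (rule recf_cong) (use True in auto)
  next
    case False
    show ?thesis
      by (rule recf_cong[OF recf_const[of _ 0]]) (use False in auto)
  qed
next
  case (Proj i)
  show ?case
  proof (cases "i < k")
    case True
    then have "recf (Suc (Suc k)) (\<lambda>xs. Suc (tl (tl xs) ! i))"
      by (intro recf_intros) auto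
    then show ?thesis
      by (rule recf_cong) (use True in auto)
  next
    case False
    show ?thesis
      by (rule recf_cong[OF recf_const[of _ 0]]) (use False in auto)
  qed
next
  case Oracle
  show ?case
  proof (cases "k = 1")
    case True
    then have "recf (Suc (Suc k)) (\<lambda>xs. if tl (tl xs) ! 0 < hd xs
        then Suc (of_bool (bit (hd (tl xs)) (tl (tl xs) ! 0))) else 0)"
      by (intro recf_intros) auto
    then show ?thesis
      by (rule recf_cong) (use True in \<open>auto simp: char_fun_def\<close>)
  next
    case False
    show ?thesis
      by (rule recf_cong[OF recf_const[of _ 0]]) (use False in auto)
  qed
next
  case (Compose f gs)
  have "recf (Suc (Suc k)) (\<lambda>xs. run (hd xs) (char_fun (bit (hd (tl xs)))) f
      (map (\<lambda>g. run (hd xs) (char_fun (bit (hd (tl xs)))) g (tl (tl xs)) - 1) gs))"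
    by (rule recf_run_compose[OF Compose.IH(1)[of "length gs"]])
      (use Compose.IH(2) in \<open>auto intro!: recf_intros\<close>)
  moreover have "recp (Suc (Suc k)) (\<lambda>xs. \<forall>g\<in>set gs. run (hd xs) (char_fun (bit (hd (tl xs)))) g (tl (tl xs)) \<noteq> 0)"
    by (intro recp_Ball_list recp_not recp_eq recf_const Compose.IH(2))
  ultimately show ?case
    unfolding run.simps by (intro recf_if recf_const)
next
  case (Prim_Rec f g)
  show ?case
  proof (cases k)
    case 0
    show ?thesis
      by (rule recf_cong[OF recf_const[of _ 0]]) (use 0 in \<open>auto simp: length_Suc_conv\<close>)
  next
    case (Suc j)
    have A: "recf (Suc (Suc (Suc j))) (\<lambda>xs. run (hd xs) (char_fun (bit (hd (tl xs)))) f (tl (tl (tl xs))))"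
      by (rule recf_run_compose[OF Prim_Rec.IH(1)[of j]]) (auto intro!: recf_intros)
    \<comment> \<open>Counter, accumulator, bound, oracle code and recursion argument stand in front
      of the parameters.\<close>
    have nth5: "recf (Suc (Suc (Suc (Suc (Suc j))))) (\<lambda>ys. tl (tl (tl (tl (tl ys)))) ! i)" if "i < j" for i
      by (rule recf_cong[OF recf_nth[of "Suc (Suc (Suc (Suc (Suc i))))"]]) (use that in \<open>auto simp: nth_tl\<close>)
    have B: "recf (Suc (Suc (Suc (Suc (Suc j)))))
      (\<lambda>ys. run (hd (tl (tl ys))) (char_fun (bit (hd (tl (tl (tl ys)))))) g
        (hd ys # (hd (tl ys) - 1) # tl (tl (tl (tl (tl ys))))))"
    proof (rule recf_run_compose[OF Prim_Rec.IH(2)[of "Suc (Suc j)"]])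
      fix i assume "i < Suc (Suc j)"
      then consider "i = 0" | "i = 1" | l where "i = Suc (Suc l)" "l < j"
        by (metis One_nat_def Suc_less_eq not0_implies_Suc)
      then show "recf (Suc (Suc (Suc (Suc (Suc j)))))
        (\<lambda>ys. (hd ys # (hd (tl ys) - 1) # tl (tl (tl (tl (tl ys))))) ! i)"
        by cases (auto intro!: nth5 recf_hd recf_diff recf_hd_tl recf_const)
    next
      show "recf (Suc (Suc (Suc (Suc (Suc j))))) (\<lambda>ys. hd (tl (tl (tl ys))))"
        by (rule recf_tl) (rule recf_hd_tl_tl)
    qed (auto intro!: recf_intros)
    have "recf (Suc (Suc (Suc j))) (\<lambda>xs. rec_nat
        (run (hd xs) (char_fun (bit (hd (tl xs)))) f (tl (tl (tl xs))))
        (\<lambda>m r. if r = 0 then 0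
          else run (hd xs) (char_fun (bit (hd (tl xs)))) g (m # (r - 1) # tl (tl (tl xs))))
        (hd (tl (tl xs))))"
      by (intro recf_rec_nat A recf_if B recp_eq recf_const recf_hd_tl recf_hd_tl_tl)
    then show ?thesis
      unfolding Suc by (rule recf_cong) (auto simp: length_Suc_conv cong del: if_weak_cong)
  qed
next
  case (Search f)
  have nth3: "recf (Suc (Suc (Suc k))) (\<lambda>ys. (hd ys # tl (tl (tl ys))) ! i)" if "i < Suc k" for i
    using that by (cases i) (auto intro!: recf_intros)
  \<comment> \<open>Inner index, outer index, bound and oracle code stand in front of the
    arguments.\<close>
  have nth4: "recf (Suc (Suc (Suc (Suc k)))) (\<lambda>ys. (hd ys # tl (tl (tl (tl ys)))) ! i)" if "i < Suc k" for i
  proof (cases i)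
    case (Suc l)
    show ?thesis
      by (rule recf_cong[OF recf_nth[of "Suc (Suc (Suc (Suc l)))"]])
        (use that Suc in \<open>auto simp: nth_tl\<close>)
  qed (auto intro!: recf_intros)
  have "recf (Suc (Suc (Suc k))) (\<lambda>ys. run (hd (tl ys)) (char_fun (bit (hd (tl (tl ys))))) f
      (hd ys # tl (tl (tl ys))))"
    by (rule recf_run_compose[OF Search.IH[of "Suc k"]]) (auto intro!: recf_hd_tl recf_hd_tl_tl nth3)
  moreover have "recf (Suc (Suc (Suc (Suc k)))) (\<lambda>ys. run (hd (tl (tl ys)))
      (char_fun (bit (hd (tl (tl (tl ys)))))) f (hd ys # tl (tl (tl (tl ys)))))"
  proof (rule recf_run_compose[OF Search.IH[of "Suc k"]])
    show "recf (Suc (Suc (Suc (Suc k)))) (\<lambda>ys. hd (tl (tl (tl ys))))"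
      by (rule recf_tl) (rule recf_hd_tl_tl)
  qed (auto intro!: recf_hd_tl_tl nth4)
  ultimately show ?case
    unfolding run.simps
    by (intro recf_sum recf_if recp_conj recp_eq recp_all recp_less recf_const recf_Suc recf_hd)
qed

lemma recf_run [recf_intros]:
  assumes "recf k S" "recf k C" "recf k N"
  shows "recf k (\<lambda>xs. run (S xs) (char_fun (bit (C xs))) e [N xs])"
  by (rule recf_run_compose[OF recf_run_env[of 1]]) (use assms in auto)

section \<open>Recursive enumerability of sets of strings\<close>

lemma recf_prod_decode:
  assumes "recf k F"
  shows "recf k (\<lambda>xs. fst (prod_decode (F xs)))" "recf k (\<lambda>xs. snd (prod_decode (F xs)))"
proof -
  \<comment> \<open>Both components of a pair are at most its code, so decoding is a finite double
    search in which only the right pair contributes. The inner sum is the triangular number of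
    Cantor's pairing.\<close>
  have delta: "(\<Sum>a<Suc p. \<Sum>b<Suc p. if (\<Sum>i<Suc (a + b). i) + a = p then h a b else 0)
      = h (fst (prod_decode p)) (snd (prod_decode p))" for p and h :: "nat \<Rightarrow> nat \<Rightarrow> nat"
  proof -
    obtain a b where ab: "prod_decode p = (a, b)"
      by (cases "prod_decode p")
    then have p: "p = prod_encode (a, b)"
      by (metis prod_decode_inverse)
    have "(\<Sum>i<Suc n. i) = triangle n" for n
      by (induction n) auto
    then have "(\<Sum>i<Suc (x + y). i) + x = prod_encode (x, y)" for x y
      by (simp add: prod_encode_def)
    then have "(\<Sum>i<Suc (x + y). i) + x = p \<longleftrightarrow> x = a \<and> y = b" for x y
      unfolding p by (simp add: prod_encode_eq)
    then have "(\<Sum>x<Suc p. \<Sum>y<Suc p. if (\<Sum>i<Suc (x + y). i) + x = p then h x y else 0)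
        = (\<Sum>x<Suc p. if x = a then \<Sum>y<Suc p. if y = b then h x y else 0 else 0)"
      by (intro sum.cong refl) (auto intro!: sum.neutral)
    also have "\<dots> = h a b"
      using le_prod_encode_1[of a b] le_prod_encode_2[of b a] unfolding p[symmetric]
      by (subst sum.delta; simp)+
    finally show ?thesis
      by (simp add: ab)
  qed
  have "recf 1 (\<lambda>xs. \<Sum>a<Suc (xs ! 0). \<Sum>b<Suc (xs ! 0). if (\<Sum>i<Suc (a + b). i) + a = xs ! 0 then a else 0)"
    by (intro recf_intros) auto
  then show "recf k (\<lambda>xs. fst (prod_decode (F xs)))"
    unfolding delta by (rule recf_compose1) fact
  have "recf 1 (\<lambda>xs. \<Sum>a<Suc (xs ! 0). \<Sum>b<Suc (xs ! 0). if (\<Sum>i<Suc (a + b). i) + a = xs ! 0 then b else 0)"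
    by (intro recf_intros) auto
  then show "recf k (\<lambda>xs. snd (prod_decode (F xs)))"
    unfolding delta by (rule recf_compose1) fact
qed

text \<open>A nonempty list has code \<open>Suc (prod_encode (x, c))\<close> with \<open>c\<close>
  the code of its tail, so subtracting one and taking the second component drops one entry.\<close>

definition drop_code :: "nat \<Rightarrow> nat \<Rightarrow> nat" where
  "drop_code n i = rec_nat n (\<lambda>_ r. snd (prod_decode (r - 1))) i"

lemma recf_drop_code [recf_intros]:
  assumes "recf k N" "recf k I"
  shows "recf k (\<lambda>xs. drop_code (N xs) (I xs))"
  unfolding drop_code_def by (intro recf_intros recf_prod_decode assms)

lemma drop_code_eq: "drop_code n i = list_encode (drop i (list_decode n))"
proof (induction i)
  case (Suc i)
  \<comment> \<open>The empty list has code \<open>0\<close>, whose truncated predecessor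
    \<open>0\<close> decodes to \<open>(0, 0)\<close>; dropping further entries therefore leaves it
    empty.\<close>
  have prod_decode_0: "prod_decode 0 = (0, 0)"
    using prod_encode_inverse[of "(0, 0)"] by (simp add: prod_encode_def)
  have "snd (prod_decode (list_encode ys - 1)) = list_encode (tl ys)" for ys
    by (cases ys) (simp_all add: prod_decode_0)
  then show ?case
    using Suc by (simp add: drop_code_def drop_Suc tl_drop)
qed (simp add: drop_code_def)

lemma list_encode_eq_0_iff: "list_encode xs = 0 \<longleftrightarrow> xs = []"
  by (cases xs) auto

lemma length_le_list_encode: "length xs \<le> list_encode xs"
proof (induction xs)
  case (Cons x xs)
  then show ?case
    using le_prod_encode_2[of "list_encode xs" x] by simp
qed simp

text \<open>The length is the number of nonempty suffixes, and it is at most the code, which bounds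
  the sum.\<close>

lemma recf_length_list_decode [recf_intros]:
  assumes "recf k N"
  shows "recf k (\<lambda>xs. length (list_decode (N xs)))"
proof -
  have "recf 1 (\<lambda>xs. \<Sum>i<xs ! 0. of_bool (drop_code (xs ! 0) i \<noteq> 0))"
    by (intro recf_intros) auto
  then have "recf k (\<lambda>xs. \<Sum>i<N xs. of_bool (drop_code (N xs) i \<noteq> 0))"
    by (rule recf_compose1) fact
  moreover have "(\<Sum>i<n. of_bool (drop_code n i \<noteq> 0)) = length (list_decode n)" for n
  proof -
    have "(\<Sum>i<n. of_bool (drop_code n i \<noteq> 0)) = card ({..<n} \<inter> {i. i < length (list_decode n)})"
      by (simp add: drop_code_eq list_encode_eq_0_iff of_bool_def sum.If_cases not_le)
    also have "{..<n} \<inter> {i. i < length (list_decode n)} = {..<length (list_decode n)}"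
      using length_le_list_encode[of "list_decode n"] by auto
    finally show ?thesis
      by simp
  qed
  ultimately show ?thesis
    by simp
qed

definition nth_code :: "nat \<Rightarrow> nat \<Rightarrow> nat" where
  "nth_code n i = fst (prod_decode (drop_code n i - 1))"

lemma recf_nth_code [recf_intros]: "recf k N \<Longrightarrow> recf k I \<Longrightarrow> recf k (\<lambda>xs. nth_code (N xs) (I xs))"
  unfolding nth_code_def by (intro recf_intros recf_prod_decode)

lemma nth_code_eq: "i < length (list_decode n) \<Longrightarrow> nth_code n i = list_decode n ! i"
  by (simp add: nth_code_def drop_code_eq Cons_nth_drop_Suc[symmetric])

section \<open>R.e. sets and their closure properties\<close>

lemma list_encode_image: "list_encode ` A = {n. list_decode n \<in> A}"
  by (auto simp: image_iff) (metis list_decode_inverse)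

text \<open>An unbounded search for a witness of a decidable relation halts exactly when a witness
  exists.\<close>

lemma re_Collect_ex:
  assumes "recp 2 (\<lambda>xs. P (xs ! 0) (list_decode (xs ! 1)))"
  shows "re {\<tau>. \<exists>s. P s \<tau>}"
proof -
  \<comment> \<open>A search looks for zeros, hence the negation.\<close>
  have "recf 2 (\<lambda>xs. of_bool (\<not> P (xs ! 0) (list_decode (xs ! 1))))"
    by (intro recf_of_bool recp_not assms)
  then obtain p where p: "oracle_free p"
    and "\<And>xs. length xs = 2 \<Longrightarrow>
      computes (\<lambda>_. 0) p xs (of_bool (\<not> P (xs ! 0) (list_decode (xs ! 1))))"
    unfolding recf_def by blast
  from this(2)[of "[_, _]"]
  have p_eq: "computes (\<lambda>_. 0) p [s, n] (of_bool (\<not> P s (list_decode n)))" for s n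
    by simp
  have "(\<exists>s. P s (list_decode n)) \<longleftrightarrow> (\<exists>y. computes (\<lambda>_. 0) (Search p) [n] y)" for n
  proof
    assume ex: "\<exists>s. P s (list_decode n)"
    define s where "s = (LEAST s. P s (list_decode n))"
    have "P s (list_decode n)" "\<And>t. t < s \<Longrightarrow> \<not> P t (list_decode n)"
      unfolding s_def using ex by (auto intro: LeastI_ex dest: not_less_Least)
    then have "computes (\<lambda>_. 0) p [s, n] 0" "\<And>t. t < s \<Longrightarrow> computes (\<lambda>_. 0) p [t, n] (Suc 0)"
      using p_eq[of _ n] by (metis of_bool_eq(1), metis One_nat_def of_bool_eq(2))
    then have "computes (\<lambda>_. 0) (Search p) [n] s"
      by (blast intro: computes.search)
    then show "\<exists>y. computes (\<lambda>_. 0) (Search p) [n] y" ..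
  next
    assume "\<exists>y. computes (\<lambda>_. 0) (Search p) [n] y"
    then obtain y where "computes (\<lambda>_. 0) p [y, n] 0"
      by (auto elim: computes.cases)
    then have "of_bool (\<not> P y (list_decode n)) = (0::nat)"
      using p_eq computes_deterministic by blast
    then show "\<exists>s. P s (list_decode n)"
      by auto
  qed
  then show ?thesis
    unfolding re_def re_nat_def list_encode_image using p by (intro exI[of _ "Search p"]) auto
qed

lemma re_Collect:
  assumes "recp 1 (\<lambda>xs. P (list_decode (xs ! 0)))"
  shows "re {\<tau>. P \<tau>}"
proof -
  have "recp 2 (\<lambda>xs. P (list_decode (xs ! 1)))"
    unfolding recp_def by (rule recf_compose1[of "\<lambda>n. of_bool (P (list_decode n))"])
      (use assms in \<open>auto simp: recp_def intro: recf_nth\<close>)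
  then show ?thesis
    using re_Collect_ex[of "\<lambda>_. P"] by simp
qed

lemma re_UNIV: "re UNIV"
proof -
  have "recp 1 (\<lambda>xs. (0::nat) \<le> 0)"
    by (intro recf_intros)
  then show ?thesis
    using re_Collect[of "\<lambda>_. True"] by simp
qed

text \<open>Composition is strict: \<open>Compose Zero [a, b]\<close> halts exactly where both
  programs halt, whatever they return.\<close>

lemma re_Int:
  assumes "re A" "re B"
  shows "re (A \<inter> B)"
proof -
  obtain a b where a: "oracle_free a" "list_encode ` A = {n. \<exists>y. computes (\<lambda>_. 0) a [n] y}"
    and b: "oracle_free b" "list_encode ` B = {n. \<exists>y. computes (\<lambda>_. 0) b [n] y}"
    using assms unfolding re_def re_nat_def by auto
  have "(\<exists>y. computes (\<lambda>_. 0) (Compose Zero [a, b]) [n] y) \<longleftrightarrow>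
    (\<exists>y. computes (\<lambda>_. 0) a [n] y) \<and> (\<exists>y. computes (\<lambda>_. 0) b [n] y)" for n
  proof
    assume "\<exists>y. computes (\<lambda>_. 0) (Compose Zero [a, b]) [n] y"
    then obtain ys where "list_all2 (\<lambda>g y. computes (\<lambda>_. 0) g [n] y) [a, b] ys"
      by (auto elim: computes.cases)
    then show "(\<exists>y. computes (\<lambda>_. 0) a [n] y) \<and> (\<exists>y. computes (\<lambda>_. 0) b [n] y)"
      by (auto simp: list_all2_Cons1)
  next
    assume "(\<exists>y. computes (\<lambda>_. 0) a [n] y) \<and> (\<exists>y. computes (\<lambda>_. 0) b [n] y)"
    then obtain y z where "list_all2 (\<lambda>g y. computes (\<lambda>_. 0) g [n] y) [a, b] [y, z]"
      by auto
    then show "\<exists>y. computes (\<lambda>_. 0) (Compose Zero [a, b]) [n] y"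
      by (blast intro: computes.compose computes.zero)
  qed
  then have "list_encode ` (A \<inter> B) = {n. \<exists>y. computes (\<lambda>_. 0) (Compose Zero [a, b]) [n] y}"
    using a(2) b(2) by (simp add: image_Int inj_list_encode) blast
  then show ?thesis
    using a(1) b(1) unfolding re_def re_nat_def by (intro exI[of _ "Compose Zero [a, b]"]) auto
qed

lemma re_INT:
  assumes "finite I" "\<And>i. i \<in> I \<Longrightarrow> re (A i)"
  shows "re (\<Inter>i\<in>I. A i)"
  using assms by (induction I) (auto intro: re_UNIV re_Int)

lemma re_extensions: "re {\<tau>. prefix \<sigma> \<tau>}"
proof -
  have "recp 1 (\<lambda>xs. length \<sigma> \<le> length (list_decode (xs ! 0)) \<and>
      (\<forall>i<length \<sigma>. nth_code (xs ! 0) i = nth_code (list_encode \<sigma>) i))"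
    by (intro recf_intros) auto
  moreover have "length \<sigma> \<le> length (list_decode n) \<and>
      (\<forall>i<length \<sigma>. nth_code n i = nth_code (list_encode \<sigma>) i) \<longleftrightarrow> prefix \<sigma> (list_decode n)" for n
  proof -
    have "prefix \<sigma> \<tau> \<longleftrightarrow> length \<sigma> \<le> length \<tau> \<and> (\<forall>i<length \<sigma>. \<tau> ! i = \<sigma> ! i)" for \<tau> :: "nat list"
      by (auto simp: prefix_def nth_append intro!: exI[of _ "drop (length \<sigma>) \<tau>"] nth_equalityI)
    then show ?thesis
      by (auto simp: nth_code_eq)
  qed
  ultimately show ?thesis
    by (intro re_Collect) simp
qed

section \<open>The coin-tossing measure\<close>

lemma space_cantor_measure [simp]: "space cantor_measure = UNIV"
  by (simp add: cantor_measure_def space_PiM)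

text \<open>A cylinder is the embedding of a product of \<open>s\<close> singletons, each of
  probability one half.\<close>

lemma cylinder:
  fixes b :: "nat \<Rightarrow> bool"
  shows "{Z. \<forall>i<s. Z i = b i} \<in> sets cantor_measure"
    and "measure cantor_measure {Z. \<forall>i<s. Z i = b i} = 1 / 2 ^ s"
proof -
  let ?M = "\<lambda>_::nat. measure_pmf (bernoulli_pmf (1 / 2))"
  let ?C = "prod_emb UNIV ?M {..<s} (\<Pi>\<^sub>E i\<in>{..<s}. {b i})"
  have M: "product_prob_space ?M"
    by (rule product_prob_spaceI) (rule prob_space_measure_pmf)
  have "Z \<in> ?C \<longleftrightarrow> restrict Z {..<s} \<in> (\<Pi>\<^sub>E i\<in>{..<s}. {b i})" for Z
    unfolding prod_emb_iff by (simp del: restrict_PiE_iff)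
  then have eq: "{Z. \<forall>i<s. Z i = b i} = ?C"
    unfolding restrict_PiE_iff by (intro set_eqI) (simp only: mem_Collect_eq lessThan_iff Ball_def singleton_iff)
  have "?C \<in> sets cantor_measure"
    unfolding cantor_measure_def by (rule sets_PiM_I) simp_all
  then show "{Z. \<forall>i<s. Z i = b i} \<in> sets cantor_measure"
    by (rule back_subst) (rule eq[symmetric])
  have half: "measure (?M i) {b i} = 1 / 2" for i
    by (cases "b i") (simp_all add: measure_pmf_single)
  have "measure cantor_measure ?C = (\<Prod>i<s. measure (?M i) {b i})"
    unfolding cantor_measure_def by (rule product_prob_space.measure_PiM_emb[OF M]) simp_all
  also have "\<dots> = 1 / 2 ^ s"
    unfolding half by (simp add: power_divide)
  finally have "measure cantor_measure ?C = 1 / 2 ^ s" .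
  with arg_cong[OF eq, of "measure cantor_measure"] show "measure cantor_measure {Z. \<forall>i<s. Z i = b i} = 1 / 2 ^ s"
    by (rule trans)
qed

interpretation cantor: prob_space cantor_measure
  unfolding cantor_measure_def by (intro prob_space_PiM prob_space_measure_pmf)

lemma bit_less_two_power: "c < 2 ^ s \<Longrightarrow> bit (c :: nat) i \<Longrightarrow> i < s"
  by (metis bit_take_bit_iff take_bit_nat_eq_self_iff)

text \<open>An event decided by the first \<open>s\<close> bits is a finite disjoint union of
  cylinders, one for each \<open>c < 2 ^ s\<close> whose digits lie in it. This turns its measure
  into a count that the calculus can handle.\<close>

lemma finite_use:
  fixes E :: "(nat \<Rightarrow> bool) set"
  assumes use: "\<And>Z Z'. (\<And>i. i < s \<Longrightarrow> Z i = Z' i) \<Longrightarrow> Z \<in> E \<Longrightarrow> Z' \<in> E"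
  shows "E \<in> sets cantor_measure"
    and "measure cantor_measure E = card {c::nat. c < 2 ^ s \<and> bit c \<in> E} / 2 ^ s"
proof -
  let ?C = "{c::nat. c < 2 ^ s \<and> bit c \<in> E}"
  let ?cyl = "\<lambda>c::nat. {Z. \<forall>i<s. Z i = bit c i}"
  have fin: "finite ?C"
    by (rule finite_subset[of _ "{..<2 ^ s}"]) auto
  have "\<exists>c\<in>?C. Z \<in> ?cyl c" if "Z \<in> E" for Z
  proof
    \<comment> \<open>The number whose binary digits are the first \<open>s\<close> bits of
      \<open>Z\<close>.\<close>
    let ?c = "horner_sum of_bool 2 (map Z [0..<s]) :: nat"
    have bit: "bit ?c i \<longleftrightarrow> i < s \<and> Z i" for i
      by (auto simp: bit_horner_sum_bit_iff)
    have "take_bit s ?c = ?c"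
      unfolding take_bit_horner_sum_bit_eq by simp
    then have "?c < 2 ^ s"
      by (metis take_bit_nat_eq_self_iff)
    then show "?c \<in> ?C"
      using use[OF _ that, of "bit ?c"] bit by auto
    show "Z \<in> ?cyl ?c"
      using bit by auto
  qed
  moreover have "Z \<in> E" if "c \<in> ?C" "Z \<in> ?cyl c" for c Z
    by (rule use[of "bit c"]) (use that in auto)
  ultimately have E: "E = (\<Union>c\<in>?C. ?cyl c)"
    by blast
  show sets: "E \<in> sets cantor_measure"
    by (subst E) (intro sets.finite_UN fin cylinder(1))
  have "disjoint_family_on ?cyl ?C"
    unfolding disjoint_family_on_def
  proof (intro ballI impI)
    fix c d assume cd: "c \<in> ?C" "d \<in> ?C" "c \<noteq> d"
    show "?cyl c \<inter> ?cyl d = {}"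
    proof (rule ccontr)
      assume "?cyl c \<inter> ?cyl d \<noteq> {}"
      then have "bit c i = bit d i" if "i < s" for i
        using that by auto
      \<comment> \<open>Both numbers are below \<open>2 ^ s\<close>, so their digits from
        \<open>s\<close> on vanish.\<close>
      then have "bit c i = bit d i" for i
        using bit_less_two_power[of c s i] bit_less_two_power[of d s i] cd by auto
      then show False
        using cd(3) by (auto intro: bit_eqI)
    qed
  qed
  then have "measure cantor_measure (\<Union>c\<in>?C. ?cyl c) = (\<Sum>c\<in>?C. measure cantor_measure (?cyl c))"
    by (intro cantor.finite_measure_finite_Union fin image_subsetI cylinder(1))
  also have "\<dots> = (\<Sum>c\<in>?C. 1 / 2 ^ s)"
    by (rule sum.cong[OF refl]) (rule cylinder(2))
  also have "\<dots> = card ?C / 2 ^ s"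
    by simp
  finally have "measure cantor_measure (\<Union>c\<in>?C. ?cyl c) = card ?C / 2 ^ s" .
  with arg_cong[OF E, of "measure cantor_measure"] show "measure cantor_measure E = card ?C / 2 ^ s"
    by (rule trans)
qed

section \<open>Oracles whose computations are bounded by a string\<close>

definition total_oracles :: "program \<Rightarrow> (nat \<Rightarrow> bool) set" where
  "total_oracles e = {Z. \<forall>n. \<exists>y. computes (char_fun Z) e [n] y}"

text \<open>Below \<open>N\<close> the bound is dropped but halting is still demanded, so obeying
  long strings approximates totality.\<close>

definition obeys :: "program \<Rightarrow> nat \<Rightarrow> nat list \<Rightarrow> (nat \<Rightarrow> bool) set" where
  "obeys e N \<tau> =
     {Z. \<forall>n<length \<tau>. \<exists>y. computes (char_fun Z) e [n] y \<and> (n < N \<or> y \<le> \<tau> ! n)}"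

text \<open>Stage \<open>s\<close> of \<open>obeys\<close>, decided by the first \<open>s\<close>
  bits of the oracle; the \<open>Suc\<close> matches the shifted results of
  \<open>run\<close>.\<close>

definition obeys_by :: "nat \<Rightarrow> program \<Rightarrow> nat \<Rightarrow> nat list \<Rightarrow> (nat \<Rightarrow> bool) set" where
  "obeys_by s e N \<tau> =
     {Z. \<forall>n<length \<tau>. run s (char_fun Z) e [n] \<noteq> 0 \<and> (n < N \<or> run s (char_fun Z) e [n] \<le> Suc (\<tau> ! n))}"

lemma obeys_by_use:
  assumes "\<And>i. i < s \<Longrightarrow> Z i = Z' i" "Z \<in> obeys_by s e N \<tau>"
  shows "Z' \<in> obeys_by s e N \<tau>"
proof -
  have "run s (char_fun Z) e xs = run s (char_fun Z') e xs" for xs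
    by (rule run_cong) (simp add: char_fun_def assms(1))
  then show ?thesis
    using assms(2) by (simp add: obeys_by_def)
qed

lemma incseq_obeys_by: "incseq (\<lambda>s. obeys_by s e N \<tau>)"
proof (rule incseq_SucI, rule subsetI)
  fix s Z assume Z: "Z \<in> obeys_by s e N \<tau>"
  have "run (Suc s) (char_fun Z) e xs = run s (char_fun Z) e xs" if "run s (char_fun Z) e xs \<noteq> 0" for xs
    using run_mono[of s _ e xs _ "Suc s"] that by (metis le_SucI not0_implies_Suc order_refl)
  then show "Z \<in> obeys_by (Suc s) e N \<tau>"
    using Z by (simp add: obeys_by_def)
qed

text \<open>Finitely many halting computations share a common step bound.\<close>

lemma obeys_eq_UN: "obeys e N \<tau> = (\<Union>s. obeys_by s e N \<tau>)"
proof (intro subset_antisym subsetI)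
  fix Z assume Z: "Z \<in> obeys e N \<tau>"
  have "eventually (\<lambda>s. \<forall>n\<in>{..<length \<tau>}. run s (char_fun Z) e [n] \<noteq> 0 \<and>
      (n < N \<or> run s (char_fun Z) e [n] \<le> Suc (\<tau> ! n))) sequentially"
  proof (rule eventually_ball_finite, simp, rule ballI)
    fix n assume "n \<in> {..<length \<tau>}"
    then obtain y where y: "computes (char_fun Z) e [n] y" "n < N \<or> y \<le> \<tau> ! n"
      using Z by (auto simp: obeys_def)
    show "eventually (\<lambda>s. run s (char_fun Z) e [n] \<noteq> 0 \<and>
      (n < N \<or> run s (char_fun Z) e [n] \<le> Suc (\<tau> ! n))) sequentially"
      using eventually_run_if_computes[OF y(1)] by eventually_elim (use y(2) in simp)
  qed
  then show "Z \<in> (\<Union>s. obeys_by s e N \<tau>)"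
    by (auto simp: obeys_by_def eventually_sequentially)
next
  fix Z assume "Z \<in> (\<Union>s. obeys_by s e N \<tau>)"
  then obtain s where s: "Z \<in> obeys_by s e N \<tau>"
    by blast
  show "Z \<in> obeys e N \<tau>"
    unfolding obeys_def
  proof (intro CollectI allI impI)
    fix n assume "n < length \<tau>"
    then have "run s (char_fun Z) e [n] \<noteq> 0" "n < N \<or> run s (char_fun Z) e [n] \<le> Suc (\<tau> ! n)"
      using s by (auto simp: obeys_by_def)
    then show "\<exists>y. computes (char_fun Z) e [n] y \<and> (n < N \<or> y \<le> \<tau> ! n)"
      using computes_if_run[of s _ e "[n]"] by (metis Suc_le_mono not0_implies_Suc)
  qed
qed

lemma sets_obeys_by: "obeys_by s e N \<tau> \<in> sets cantor_measure"
  by (rule finite_use) (rule obeys_by_use)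

lemma sets_obeys [measurable]: "obeys e N \<tau> \<in> sets cantor_measure"
  unfolding obeys_eq_UN by (intro sets.countable_UN) (auto intro: sets_obeys_by)

text \<open>Continuity from below along the stages; because the inequality is strict, it already
  shows at a finite stage.\<close>

lemma less_measure_obeys_iff:
  "q < measure cantor_measure (obeys e N \<tau>) \<longleftrightarrow> (\<exists>s. q < measure cantor_measure (obeys_by s e N \<tau>))"
proof
  have "(\<lambda>s. measure cantor_measure (obeys_by s e N \<tau>)) \<longlonglongrightarrow> measure cantor_measure (obeys e N \<tau>)"
    unfolding obeys_eq_UN
    by (intro cantor.finite_Lim_measure_incseq incseq_obeys_by) (auto intro: sets_obeys_by)
  moreover assume "q < measure cantor_measure (obeys e N \<tau>)"
  ultimately have "eventually (\<lambda>s. q < measure cantor_measure (obeys_by s e N \<tau>)) sequentially"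
    by (rule order_tendstoD(1))
  then show "\<exists>s. q < measure cantor_measure (obeys_by s e N \<tau>)"
    by (auto dest: eventually_happens)
next
  assume "\<exists>s. q < measure cantor_measure (obeys_by s e N \<tau>)"
  then obtain s where "q < measure cantor_measure (obeys_by s e N \<tau>)" ..
  also have "\<dots> \<le> measure cantor_measure (obeys e N \<tau>)"
    by (intro cantor.finite_measure_mono) (auto simp: obeys_eq_UN intro: sets_obeys_by)
  finally show "q < measure cantor_measure (obeys e N \<tau>)" .
qed

text \<open>By \<open>less_measure_obeys_iff\<close> and \<open>finite_use\<close>, the condition
  asks for a stage \<open>s\<close> at which a count divided by \<open>2 ^ s\<close> exceeds
  \<open>q\<close>. For rational \<open>q\<close> this comparison is decidable.\<close>

lemma re_measure_obeys_greater:
  assumes "q \<in> \<rat>"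
  shows "re {\<tau>. q < measure cantor_measure (obeys e N \<tau>)}"
proof (cases "q < 0")
  case True
  then have "q < measure cantor_measure (obeys e N \<tau>)" for \<tau>
    using measure_nonneg[of cantor_measure "obeys e N \<tau>"] by linarith
  then show ?thesis
    using re_UNIV by simp
next
  case False
  then obtain a b :: nat where b: "b \<noteq> 0" and q: "q = a / b"
    using Rats_abs_nat_div_natE[OF assms] by (metis abs_of_nonneg not_less)
  have card: "(\<Sum>c<2 ^ s. of_bool (bit (c::nat) \<in> obeys_by s e N \<tau>)) =
      card {c::nat. c < 2 ^ s \<and> bit c \<in> obeys_by s e N \<tau>}" for s \<tau>
    by (simp add: of_bool_def sum.If_cases lessThan_def Collect_conj_eq)
  \<comment> \<open>Clearing denominators leaves an inequality between natural numbers.\<close>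
  have "q < measure cantor_measure (obeys_by s e N \<tau>) \<longleftrightarrow>
      a * 2 ^ s < b * (\<Sum>c<2 ^ s. of_bool (bit (c::nat) \<in> obeys_by s e N \<tau>))" for s \<tau>
  proof -
    let ?k = "card {c::nat. c < 2 ^ s \<and> bit c \<in> obeys_by s e N \<tau>}"
    have "q < measure cantor_measure (obeys_by s e N \<tau>) \<longleftrightarrow> real a / real b < real ?k / 2 ^ s"
      unfolding q by (subst finite_use(2)[OF obeys_by_use]) auto
    also have "\<dots> \<longleftrightarrow> real (a * 2 ^ s) < real (b * ?k)"
      using b by (simp add: field_simps)
    finally show ?thesis
      unfolding card of_nat_less_iff .
  qed
  moreover have "recp 2 (\<lambda>xs. a * 2 ^ (xs ! 0) < b * (\<Sum>c<2 ^ (xs ! 0).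
      of_bool (bit (c::nat) \<in> obeys_by (xs ! 0) e N (list_decode (xs ! 1)))))"
  proof -
    have "recp 2 (\<lambda>xs. a * 2 ^ (xs ! 0) < b * (\<Sum>c<2 ^ (xs ! 0).
      of_bool (\<forall>n<length (list_decode (xs ! 1)). run (xs ! 0) (char_fun (bit (c::nat))) e [n] \<noteq> 0 \<and>
        (n < N \<or> run (xs ! 0) (char_fun (bit c)) e [n] \<le> Suc (nth_code (xs ! 1) n)))))"
      by (intro recf_intros) auto
    then show ?thesis
      by (rule recp_cong) (simp add: obeys_by_def nth_code_eq)
  qed
  ultimately show ?thesis
    unfolding less_measure_obeys_iff by (intro re_Collect_ex) simp
qed

section \<open>Dependence on the string and approximation of totality\<close>

lemma obeys_antimono: "prefix \<sigma> \<tau> \<Longrightarrow> obeys e N \<tau> \<subseteq> obeys e N \<sigma>"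
proof -
  assume "prefix \<sigma> \<tau>"
  then have "n < length \<tau> \<and> \<tau> ! n = \<sigma> ! n" if "n < length \<sigma>" for n
    using that by (auto simp: prefix_def nth_append)
  then show ?thesis
    unfolding obeys_def by (intro Collect_mono) metis
qed

lemma obeys_append:
  "obeys e N (\<sigma> @ [m]) =
    obeys e N \<sigma> \<inter> {Z. \<exists>y. computes (char_fun Z) e [length \<sigma>] y \<and> (length \<sigma> < N \<or> y \<le> m)}"
proof -
  have "Z \<in> obeys e N (\<sigma> @ [m]) \<longleftrightarrow> Z \<in> obeys e N \<sigma> \<and>
      (\<exists>y. computes (char_fun Z) e [length \<sigma>] y \<and> (length \<sigma> < N \<or> y \<le> m))" for Z
    unfolding obeys_def by (simp add: All_less_Suc nth_append cong: conj_cong) blast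
  then show ?thesis
    by blast
qed

text \<open>When the cutoff equals the length, no entry is ever compared with an output, so the
  zeros are mere padding.\<close>

lemma obeys_replicate_0: "obeys e N (replicate N 0) = {Z. \<forall>n<N. \<exists>y. computes (char_fun Z) e [n] y}"
  by (simp add: obeys_def)

lemma decseq_obeys_replicate_0: "decseq (\<lambda>N. obeys e N (replicate N 0))"
  unfolding obeys_replicate_0 by (rule decseq_SucI) auto

lemma total_oracles_eq_INT: "total_oracles e = (\<Inter>N. obeys e N (replicate N 0))"
  unfolding obeys_replicate_0 by (auto simp: total_oracles_def)

lemma total_oracles_subset_obeys_replicate_0: "total_oracles e \<subseteq> obeys e N (replicate N 0)"
  unfolding total_oracles_eq_INT by blast

lemma sets_total_oracles [measurable]: "total_oracles e \<in> sets cantor_measure"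
  unfolding total_oracles_eq_INT by (intro sets.countable_INT) auto

text \<open>Continuity from above: the oracles that halt on all inputs below \<open>N\<close>
  decrease to the total ones.\<close>

lemma measure_obeys_minus_total_tendsto_0:
  "(\<lambda>N. measure cantor_measure (obeys e N (replicate N 0) - total_oracles e)) \<longlonglongrightarrow> 0"
proof -
  have "(\<lambda>N. measure cantor_measure (obeys e N (replicate N 0))) \<longlonglongrightarrow> measure cantor_measure (total_oracles e)"
    unfolding total_oracles_eq_INT
    by (intro cantor.finite_Lim_measure_decseq decseq_obeys_replicate_0) auto
  then have "(\<lambda>N. measure cantor_measure (obeys e N (replicate N 0)) - measure cantor_measure (total_oracles e)) \<longlonglongrightarrow> 0"
    using LIM_zero by blast
  moreover have "measure cantor_measure (obeys e N (replicate N 0) - total_oracles e) =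
      measure cantor_measure (obeys e N (replicate N 0)) - measure cantor_measure (total_oracles e)" for N
    by (intro cantor.finite_measure_Diff sets_obeys sets_total_oracles total_oracles_subset_obeys_replicate_0)
  ultimately show ?thesis
    by simp
qed

section \<open>The forcing conditions\<close>

text \<open>Intersecting with the total oracles is what lets a string always be extended, see
  \<open>keeps_append\<close>.\<close>

definition keeps :: "nat list \<Rightarrow> (program \<times> nat \<times> real) set \<Rightarrow> bool" where
  "keeps \<sigma> P \<longleftrightarrow> (\<forall>(e, N, q)\<in>P. q < measure cantor_measure (obeys e N \<sigma> \<inter> total_oracles e))"

lemma keeps_prefix:
  assumes "keeps \<tau> P" "prefix \<sigma> \<tau>" "Q \<subseteq> P"
  shows "keeps \<sigma> Q"
proof -
  have "measure cantor_measure (obeys e N \<tau> \<inter> total_oracles e) \<le> measure cantor_measure (obeys e N \<sigma> \<inter> total_oracles e)" for e N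
    using obeys_antimono[OF assms(2)] by (intro cantor.finite_measure_mono) auto
  then show ?thesis
    using assms(1,3) unfolding keeps_def by (force intro: less_le_trans)
qed

text \<open>On a total oracle the next value exists, so as the new entry \<open>m\<close> grows the
  events increase to the old one and their measures converge to its measure. The promises are strict
  and finitely many, hence all hold for large \<open>m\<close>.\<close>

lemma keeps_append:
  assumes "finite P" "keeps \<sigma> P"
  shows "\<exists>m. keeps (\<sigma> @ [m]) P"
proof -
  have "eventually (\<lambda>m. q < measure cantor_measure (obeys e N (\<sigma> @ [m]) \<inter> total_oracles e)) sequentially"
    if "(e, N, q) \<in> P" for e N q
  proof -
    have "incseq (\<lambda>m. obeys e N (\<sigma> @ [m]) \<inter> total_oracles e)"
      unfolding obeys_append by (rule incseq_SucI) (auto intro: le_SucI)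
    then have "(\<lambda>m. measure cantor_measure (obeys e N (\<sigma> @ [m]) \<inter> total_oracles e)) \<longlonglongrightarrow>
        measure cantor_measure (\<Union>m. obeys e N (\<sigma> @ [m]) \<inter> total_oracles e)"
      by (intro cantor.finite_Lim_measure_incseq) auto
    also have "(\<Union>m. obeys e N (\<sigma> @ [m]) \<inter> total_oracles e) = obeys e N \<sigma> \<inter> total_oracles e"
    proof
      show "(\<Union>m. obeys e N (\<sigma> @ [m]) \<inter> total_oracles e) \<subseteq> obeys e N \<sigma> \<inter> total_oracles e"
        unfolding obeys_append by blast
    next
      show "obeys e N \<sigma> \<inter> total_oracles e \<subseteq> (\<Union>m. obeys e N (\<sigma> @ [m]) \<inter> total_oracles e)"
      proof
        fix Z assume Z: "Z \<in> obeys e N \<sigma> \<inter> total_oracles e"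
        then obtain y where "computes (char_fun Z) e [length \<sigma>] y"
          by (auto simp: total_oracles_def)
        then have "Z \<in> obeys e N (\<sigma> @ [y]) \<inter> total_oracles e"
          using Z by (auto simp: obeys_append)
        then show "Z \<in> (\<Union>m. obeys e N (\<sigma> @ [m]) \<inter> total_oracles e)"
          by blast
      qed
    qed
    finally show ?thesis
      using assms(2) that by (intro order_tendstoD(1)) (auto simp: keeps_def)
  qed
  then have "\<forall>p\<in>P. eventually (\<lambda>m. case p of (e, N, q) \<Rightarrow>
      q < measure cantor_measure (obeys e N (\<sigma> @ [m]) \<inter> total_oracles e)) sequentially"
    by auto
  from eventually_ball_finite[OF assms(1) this] show ?thesis
    unfolding keeps_def by (auto dest: eventually_happens)
qed

lemma keeps_extend:
  assumes "finite P" "keeps \<sigma> P"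
  shows "\<exists>\<tau>. prefix \<sigma> \<tau> \<and> k \<le> length \<tau> \<and> keeps \<tau> P"
proof (induction k)
  case 0
  then show ?case
    using assms(2) by auto
next
  case (Suc k)
  then obtain \<tau> where \<tau>: "prefix \<sigma> \<tau>" "k \<le> length \<tau>" "keeps \<tau> P"
    by blast
  then show ?case
    using keeps_append[OF assms(1) \<tau>(3)] by (metis Suc_le_mono length_append_singleton prefix_prefix)
qed

lemma obeys_subset_replicate_0: "k \<le> length \<tau> \<Longrightarrow> obeys e N \<tau> \<subseteq> obeys e k (replicate k 0)"
  unfolding obeys_replicate_0 obeys_def by (intro Collect_mono) (simp, blast intro: order.strict_trans2)

lemma keepsD: "keeps \<sigma> P \<Longrightarrow> (e, N, q) \<in> P \<Longrightarrow> q < measure cantor_measure (obeys e N \<sigma> \<inter> total_oracles e)"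
  by (auto simp: keeps_def)

text \<open>Bounds raised to rationals strictly below the actual measures are still kept, so the
  string can be lengthened until each gap between approximate and true totality is smaller than the
  amount of the raise.\<close>

lemma keeps_raise:
  assumes P: "finite P" "keeps \<sigma> P"
  shows "\<exists>\<rho> Q. prefix \<sigma> \<rho> \<and> finite Q \<and> keeps \<rho> Q \<and> (\<forall>(e, N, q)\<in>Q. q \<in> \<rat>) \<and>
    (\<forall>(e, N, q)\<in>P. \<exists>q'. (e, N, q') \<in> Q \<and>
      q + measure cantor_measure (obeys e (length \<rho>) (replicate (length \<rho>) 0) - total_oracles e) < q')"
proof -
  have "\<exists>q'\<in>\<rat>. q < q' \<and> q' < measure cantor_measure (obeys e N \<sigma> \<inter> total_oracles e)" if "(e, N, q) \<in> P" for e N q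
    using P(2) that Rats_dense_in_real[of q] by (fastforce simp: keeps_def)
  then obtain r where r: "\<And>e N q. (e, N, q) \<in> P \<Longrightarrow> r e N q \<in> \<rat> \<and> q < r e N q \<and>
      r e N q < measure cantor_measure (obeys e N \<sigma> \<inter> total_oracles e)"
    by metis
  let ?Q = "(\<lambda>(e, N, q). (e, N, r e N q)) ` P"
  let ?gap = "\<lambda>e k. measure cantor_measure (obeys e k (replicate k 0) - total_oracles e)"
  have "\<forall>p\<in>P. eventually (\<lambda>k. case p of (e, N, q) \<Rightarrow> q + ?gap e k < r e N q) sequentially"
  proof clarify
    fix e N q assume "(e, N, q) \<in> P"
    then have "eventually (\<lambda>k. ?gap e k < r e N q - q) sequentially"
      using r by (intro order_tendstoD(2)[OF measure_obeys_minus_total_tendsto_0]) auto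
    then show "eventually (\<lambda>k. q + ?gap e k < r e N q) sequentially"
      by eventually_elim linarith
  qed
  from eventually_ball_finite[OF P(1) this] obtain k where
    k: "\<And>l e N q. k \<le> l \<Longrightarrow> (e, N, q) \<in> P \<Longrightarrow> q + ?gap e l < r e N q"
    unfolding eventually_sequentially by fast
  have "finite ?Q" "keeps \<sigma> ?Q"
    using P(1) r by (auto simp: keeps_def)
  then obtain \<rho> where \<rho>: "prefix \<sigma> \<rho>" "k \<le> length \<rho>" "keeps \<rho> ?Q"
    using keeps_extend by blast
  show ?thesis
  proof (intro exI conjI)
    show "\<forall>(e, N, q)\<in>?Q. q \<in> \<rat>"
      using r by auto
    show "\<forall>(e, N, q)\<in>P. \<exists>q'. (e, N, q') \<in> ?Q \<and> q + ?gap e (length \<rho>) < q'"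
      using k[OF \<rho>(2)] by force
  qed fact+
qed

section \<open>Initial segments of functions\<close>

lemma take_restrict_to: "m \<le> n \<Longrightarrow> take m (f \<restriction> n) = f \<restriction> m"
  by (simp add: restrict_to_def take_map)

lemma prefix_restrict_to: "m \<le> n \<Longrightarrow> prefix (f \<restriction> m) (f \<restriction> n)"
  using take_is_prefix[of m "f \<restriction> n"] by (simp add: take_restrict_to)

lemma length_restrict_to [simp]: "length (f \<restriction> n) = n"
  by (simp add: restrict_to_def)

lemma prefix_restrict_toD:
  assumes "prefix \<sigma> (f \<restriction> n)"
  shows "\<sigma> = f \<restriction> length \<sigma>"
proof -
  have "\<sigma> = take (length \<sigma>) (f \<restriction> n)"
    using assms by (auto simp: prefix_def)
  then show ?thesis
    using prefix_length_le[OF assms] by (simp add: take_restrict_to)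
qed

lemma prefix_initial_segment: "initial_segment \<tau> f \<Longrightarrow> prefix \<sigma> \<tau> \<Longrightarrow> initial_segment \<sigma> f"
  unfolding initial_segment_def by (elim exE) (rule exI, rule prefix_restrict_toD, simp)

text \<open>The functions that the forcing condition \<open>(\<sigma>, P)\<close> leaves
  possible.\<close>

definition meets :: "(nat \<Rightarrow> nat) \<Rightarrow> nat list \<Rightarrow> (program \<times> nat \<times> real) set \<Rightarrow> bool" where
  "meets f \<sigma> P \<longleftrightarrow> initial_segment \<sigma> f \<and> (\<forall>n. keeps (f \<restriction> n) P)"

text \<open>One clause of \<open>sigma1_dense_in\<close> is refuted in either case: an available
  \<open>y\<close> becomes an initial segment of \<open>f\<close>, and failing that an r.e. dense
  set contains no extension of a member of \<open>Y\<close>.\<close>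

lemma force_not_sigma1_dense:
  assumes P: "finite P" "keeps \<sigma> P"
  shows "\<exists>\<rho> Q. prefix \<sigma> \<rho> \<and> P \<subseteq> Q \<and> finite Q \<and> keeps \<rho> Q \<and>
    (\<forall>f. meets f \<rho> Q \<longrightarrow> \<not> sigma1_dense_in Y f)"
proof (cases "\<exists>y\<in>Y. prefix y \<sigma> \<or> prefix \<sigma> y \<and> keeps y P")
  case True
  then obtain y where y: "y \<in> Y" "prefix y \<sigma> \<or> prefix \<sigma> y \<and> keeps y P"
    by blast
  \<comment> \<open>The longer of \<open>y\<close> and \<open>\<sigma>\<close> serves as
    \<open>\<rho>\<close>.\<close>
  then obtain \<rho> where "prefix \<sigma> \<rho>" "prefix y \<rho>" "keeps \<rho> P"
    using P(2) by auto
  then show ?thesis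
    using y(1) P(1) prefix_initial_segment unfolding meets_def sigma1_dense_in_def by blast
next
  case False
  obtain \<rho> Q where \<rho>: "prefix \<sigma> \<rho>" and Q: "finite Q" "keeps \<rho> Q" "\<And>e N q. (e, N, q) \<in> Q \<Longrightarrow> q \<in> \<rat>"
    and PQ: "\<And>e N q. (e, N, q) \<in> P \<Longrightarrow> \<exists>q'. (e, N, q') \<in> Q \<and>
      q + measure cantor_measure (obeys e (length \<rho>) (replicate (length \<rho>) 0) - total_oracles e) < q'"
    using keeps_raise[OF P] by (auto split: prod.splits)
  \<comment> \<open>Measuring over all oracles, against rational bounds, makes this set r.e.\<close>
  let ?W = "{\<tau>. prefix \<rho> \<tau>} \<inter> (\<Inter>(e, N, q)\<in>Q. {\<tau>. q < measure cantor_measure (obeys e N \<tau>)})"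
  have W_re: "re ?W"
    by (intro re_Int re_extensions re_INT Q(1)) (auto split: prod.splits intro: re_measure_obeys_greater Q(3))
  have W_keeps: "keeps \<tau> P" if "\<tau> \<in> ?W" for \<tau>
    unfolding keeps_def
  proof clarify
    fix e N q assume "(e, N, q) \<in> P"
    then obtain q' where q': "(e, N, q') \<in> Q"
      "q + measure cantor_measure (obeys e (length \<rho>) (replicate (length \<rho>) 0) - total_oracles e) < q'"
      using PQ by blast
    have "q' < measure cantor_measure (obeys e N \<tau>)"
      using that q'(1) by auto
    \<comment> \<open>The non-total oracles are split off. Those obeying \<open>\<tau>\<close> halt
      on all inputs below \<open>length \<rho>\<close>, so their measure is less than
      \<open>q' - q\<close>.\<close>
    also have "\<dots> = measure cantor_measure (obeys e N \<tau> \<inter> total_oracles e) + measure cantor_measure (obeys e N \<tau> - total_oracles e)"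
      by (subst cantor.finite_measure_Union[symmetric]) (auto intro: arg_cong[of _ _ "measure cantor_measure"])
    also have "measure cantor_measure (obeys e N \<tau> - total_oracles e) \<le>
      measure cantor_measure (obeys e (length \<rho>) (replicate (length \<rho>) 0) - total_oracles e)"
      using that obeys_subset_replicate_0[OF prefix_length_le[of \<rho> \<tau>], of e N]
      by (intro cantor.finite_measure_mono Diff_mono sets.Diff sets_obeys sets_total_oracles) auto
    finally show "q < measure cantor_measure (obeys e N \<tau> \<inter> total_oracles e)"
      using q'(2) by linarith
  qed
  have "\<not> sigma1_dense_in Y f" if f: "meets f \<rho> (P \<union> Q)" for f
  proof
    assume Y: "sigma1_dense_in Y f"
    \<comment> \<open>Promises kept over the total oracles hold all the more over all
      oracles.\<close>
    have init: "f \<restriction> n \<in> ?W" if "length \<rho> \<le> n" for n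
    proof -
      have "prefix \<rho> (f \<restriction> n)"
        using f that prefix_restrict_to unfolding meets_def initial_segment_def by fastforce
      moreover have "q < measure cantor_measure (obeys e N (f \<restriction> n))" if "(e, N, q) \<in> Q" for e N q
      proof -
        have "q < measure cantor_measure (obeys e N (f \<restriction> n) \<inter> total_oracles e)"
          using f that by (intro keepsD[of _ "P \<union> Q"]) (auto simp: meets_def)
        also have "\<dots> \<le> measure cantor_measure (obeys e N (f \<restriction> n))"
          by (intro cantor.finite_measure_mono) auto
        finally show ?thesis .
      qed
      ultimately show ?thesis
        by auto
    qed
    have "dense_in ?W f"
      unfolding dense_in_def
    proof
      fix n
      show "\<exists>\<sigma>\<in>?W. prefix (f \<restriction> n) \<sigma>"
        by (rule bexI[OF _ init[of "max n (length \<rho>)"]]) (auto intro: prefix_restrict_to)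
    qed
    then obtain \<tau> y where \<tau>: "\<tau> \<in> ?W" and y: "y \<in> Y" "prefix y \<tau>"
      using Y W_re unfolding sigma1_dense_in_def by blast
    have "prefix \<sigma> \<tau>"
      using \<tau> \<rho> by (auto intro: prefix_order.trans)
    \<comment> \<open>Both are prefixes of \<open>\<tau>\<close>, hence comparable. As
      \<open>y\<close> inherits the promises \<open>P\<close> from \<open>\<tau>\<close>, either
      alternative contradicts the case assumption.\<close>
    then have "prefix y \<sigma> \<or> prefix \<sigma> y"
      using y(2) by (metis prefix_same_cases)
    moreover have "keeps y P"
      using W_keeps[OF \<tau>] y(2) by (rule keeps_prefix) simp
    ultimately show False
      using False y(1) by blast
  qed
  moreover have "keeps \<rho> (P \<union> Q)"
  proof -
    \<comment> \<open>\<open>\<rho>\<close> belongs to the dense set itself, so it keeps the old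
      promises along with the raised ones.\<close>
    have "\<rho> \<in> ?W"
    proof -
      have "q < measure cantor_measure (obeys e N \<rho>)" if "(e, N, q) \<in> Q" for e N q
      proof -
        have "q < measure cantor_measure (obeys e N \<rho> \<inter> total_oracles e)"
          using Q(2) that by (auto simp: keeps_def)
        also have "\<dots> \<le> measure cantor_measure (obeys e N \<rho>)"
          by (intro cantor.finite_measure_mono) auto
        finally show ?thesis .
      qed
      then show ?thesis
        by auto
    qed
    then have "keeps \<rho> P"
      by (rule W_keeps)
    then show ?thesis
      using Q(2) by (auto simp: keeps_def)
  qed
  ultimately show ?thesis
    using \<rho> P(1) Q(1) by (intro exI[of _ \<rho>] exI[of _ "P \<union> Q"] conjI allI impI) simp_all
qed

lemma condition_step:
  assumes P: "finite P" "keeps \<sigma> P"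
  shows "\<exists>\<rho> Q. prefix \<sigma> \<rho> \<and> length \<sigma> < length \<rho> \<and> P \<subseteq> Q \<and> finite Q \<and> keeps \<rho> Q \<and>
    (\<forall>f. meets f \<rho> Q \<longrightarrow> \<not> sigma1_dense_in Y f) \<and>
    (\<exists>N. (e, N, measure cantor_measure (total_oracles e) - 1 / Suc k) \<in> Q)"
proof -
  obtain \<rho> Q where \<rho>: "prefix \<sigma> \<rho>" and Q: "P \<subseteq> Q" "finite Q" "keeps \<rho> Q"
    and force: "\<And>f. meets f \<rho> Q \<Longrightarrow> \<not> sigma1_dense_in Y f"
    using force_not_sigma1_dense[OF P, of Y] by blast
  \<comment> \<open>With the cutoff at \<open>length \<rho>\<close> the new promise constrains none
    of the entries already chosen. The whole measure of the total oracles is available and exceeds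
    the promised bound by \<open>1 / Suc k\<close>.\<close>
  define R where "R = insert (e, length \<rho>, measure cantor_measure (total_oracles e) - 1 / Suc k) Q"
  have "total_oracles e \<subseteq> obeys e (length \<rho>) \<rho>"
    unfolding obeys_def total_oracles_def by blast
  then have "obeys e (length \<rho>) \<rho> \<inter> total_oracles e = total_oracles e"
    by (rule Int_absorb1)
  then have R: "Q \<subseteq> R" "finite R" "keeps \<rho> R"
    using Q(2,3) by (auto simp: R_def keeps_def)
  from keeps_extend[OF R(2,3), of "Suc (length \<sigma>)"] obtain \<tau> where
    \<tau>: "prefix \<rho> \<tau>" "length \<sigma> < length \<tau>" "keeps \<tau> R"
    by (auto simp: Suc_le_eq)
  have "\<not> sigma1_dense_in Y f" if f: "meets f \<tau> R" for f
  proof (rule force)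
    have "initial_segment \<tau> f" and keeps_R: "keeps (f \<restriction> n) R" for n
      using f by (simp_all add: meets_def)
    then have "initial_segment \<rho> f"
      using \<tau>(1) by (blast intro: prefix_initial_segment)
    moreover have "keeps (f \<restriction> n) Q" for n
      using keeps_R prefix_order.refl R(1) by (rule keeps_prefix)
    ultimately show "meets f \<rho> Q"
      unfolding meets_def by simp
  qed
  moreover have "prefix \<sigma> \<tau>"
    using \<rho> \<tau>(1) by (rule prefix_order.trans)
  moreover have "P \<subseteq> R"
    using Q(1) R(1) by (rule subset_trans)
  moreover have "\<exists>N. (e, N, measure cantor_measure (total_oracles e) - 1 / Suc k) \<in> R"
    unfolding R_def by blast
  ultimately show ?thesis
    using \<tau>(2,3) R(2) by blast
qed

section \<open>The generic function\<close>

instance program :: countable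
  by countable_datatype

text \<open>For each program, the oracles whose outputs are eventually bounded by \<open>f\<close>
  fill the total oracles up to arbitrarily small measure, hence up to a null set. The union of these
  null sets over the countably many programs is null.\<close>

lemma uniformly_ae_dominatingI:
  assumes f: "\<And>e k. \<exists>N. \<forall>n. measure cantor_measure (total_oracles e) - 1 / Suc k <
    measure cantor_measure (obeys e N (f \<restriction> n) \<inter> total_oracles e)"
  shows "uniformly_ae_dominating f"
proof -
  define good where "good e = (\<Union>N. \<Inter>n. obeys e N (f \<restriction> n) \<inter> total_oracles e)" for e
  have good_iff: "Z \<in> good e \<longleftrightarrow>
      Z \<in> total_oracles e \<and> (\<exists>N. \<forall>n\<ge>N. \<exists>y\<le>f n. computes (char_fun Z) e [n] y)" for Z e
  proof -
    have "Z \<in> obeys e N (f \<restriction> n) \<longleftrightarrow>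
        (\<forall>m<n. \<exists>y. computes (char_fun Z) e [m] y \<and> (m < N \<or> y \<le> f m))" for N n
      by (simp add: obeys_def restrict_to_def)
    then have all: "(\<forall>n. Z \<in> obeys e N (f \<restriction> n)) \<longleftrightarrow>
        (\<forall>m. \<exists>y. computes (char_fun Z) e [m] y \<and> (m < N \<or> y \<le> f m))" for N
      using lessI by blast
    have bounded: "(\<forall>m. \<exists>y. computes (char_fun Z) e [m] y \<and> (m < N \<or> y \<le> f m)) \<longleftrightarrow>
        (\<forall>m\<ge>N. \<exists>y\<le>f m. computes (char_fun Z) e [m] y)" if "Z \<in> total_oracles e" for N
    proof (intro iffI allI impI)
      fix m assume "\<forall>m. \<exists>y. computes (char_fun Z) e [m] y \<and> (m < N \<or> y \<le> f m)" "N \<le> m"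
      then show "\<exists>y\<le>f m. computes (char_fun Z) e [m] y"
        unfolding linorder_not_less[symmetric] by blast
    next
      fix m assume bound: "\<forall>m\<ge>N. \<exists>y\<le>f m. computes (char_fun Z) e [m] y"
      show "\<exists>y. computes (char_fun Z) e [m] y \<and> (m < N \<or> y \<le> f m)"
      proof (cases "m < N")
        case True
        then show ?thesis
          using that unfolding total_oracles_def by blast
      next
        case False
        then show ?thesis
          using bound unfolding linorder_not_less by blast
      qed
    qed
    have "Z \<in> good e \<longleftrightarrow> Z \<in> total_oracles e \<and> (\<exists>N. \<forall>n. Z \<in> obeys e N (f \<restriction> n))"
      unfolding good_def by blast
    then show ?thesis
      unfolding all using bounded by (cases "Z \<in> total_oracles e") simp_all
  qed
  have sets_good: "good e \<in> sets cantor_measure" for e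
    unfolding good_def by (intro sets.countable_UN sets.countable_INT sets.Int image_subsetI sets_obeys sets_total_oracles) auto
  have "measure cantor_measure (total_oracles e) - 1 / Suc k \<le> measure cantor_measure (good e)" for e k
  proof -
    let ?A = "\<lambda>N n. obeys e N (f \<restriction> n) \<inter> total_oracles e"
    obtain N where N: "\<And>n. measure cantor_measure (total_oracles e) - 1 / Suc k < measure cantor_measure (?A N n)"
      using f by blast
    have "decseq (?A N)"
      using obeys_antimono[OF prefix_restrict_to] by (intro decseq_SucI Int_mono) auto
    then have "(\<lambda>n. measure cantor_measure (?A N n)) \<longlonglongrightarrow> measure cantor_measure (\<Inter>n. ?A N n)"
      by (intro cantor.finite_Lim_measure_decseq) auto
    \<comment> \<open>The strict bound at every length survives in the limit as a weak one.\<close>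
    then have "measure cantor_measure (total_oracles e) - 1 / Suc k \<le> measure cantor_measure (\<Inter>n. ?A N n)"
      by (rule LIMSEQ_le_const) (use N less_imp_le in blast)
    also have "\<dots> \<le> measure cantor_measure (good e)"
      by (rule cantor.finite_measure_mono[OF _ sets_good]) (auto simp: good_def)
    finally show ?thesis .
  qed
  \<comment> \<open>The error \<open>1 / Suc k\<close> vanishes as \<open>k\<close> tends to
    infinity.\<close>
  then have "measure cantor_measure (total_oracles e) \<le> measure cantor_measure (good e)" for e
    by (intro LIMSEQ_le_const2[OF LIMSEQ_inverse_real_of_nat_add_minus[of "measure cantor_measure (total_oracles e)"]])
      (auto simp: inverse_eq_divide)
  moreover have good_sub: "good e \<subseteq> total_oracles e" for e
    by (auto simp: good_def)
  ultimately have "measure cantor_measure (total_oracles e - good e) = 0" for e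
    using cantor.finite_measure_Diff[OF sets_total_oracles sets_good good_sub, of e]
      cantor.finite_measure_mono[OF good_sub sets_total_oracles, of e] by (metis order_antisym diff_self)
  then have "total_oracles e - good e \<in> null_sets cantor_measure" for e
    using sets_good by (intro null_setsI) (auto simp: cantor.emeasure_eq_measure)
  then have null: "(\<Union>e. total_oracles e - good e) \<in> null_sets cantor_measure"
    by (rule null_sets_UN)
  \<comment> \<open>The set is exactly the complement of a null set, which settles its measurability
    as well as its measure.\<close>
  have "{Z. \<forall>g. g \<le>\<^sub>T char_fun Z \<longrightarrow> g \<le>\<^sup>* f} = space cantor_measure - (\<Union>e. total_oracles e - good e)"
  proof -
    have "(\<forall>g. g \<le>\<^sub>T char_fun Z \<longrightarrow> g \<le>\<^sup>* f) \<longleftrightarrow> (\<forall>e. Z \<in> total_oracles e \<longrightarrow> Z \<in> good e)" for Z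
    proof (intro iffI allI impI)
      fix e assume dom: "\<forall>g. g \<le>\<^sub>T char_fun Z \<longrightarrow> g \<le>\<^sup>* f" and Z: "Z \<in> total_oracles e"
      then obtain g where g: "\<And>n. computes (char_fun Z) e [n] (g n)"
        unfolding total_oracles_def mem_Collect_eq by metis
      then have "g \<le>\<^sup>* f"
        using dom unfolding turing_le_def by blast
      then show "Z \<in> good e"
        using Z g unfolding good_iff le_star_def by blast
    next
      fix g assume good: "\<forall>e. Z \<in> total_oracles e \<longrightarrow> Z \<in> good e" and "g \<le>\<^sub>T char_fun Z"
      then obtain e where e: "\<And>n. computes (char_fun Z) e [n] (g n)"
        unfolding turing_le_def by blast
      then have "Z \<in> good e"
        using good unfolding total_oracles_def by blast
      then show "g \<le>\<^sup>* f"
        using computes_deterministic[OF e] unfolding good_iff le_star_def by metis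
    qed
    then show ?thesis
      by auto
  qed
  then show ?thesis
    unfolding uniformly_ae_dominating_def
    using cantor.prob_compl[OF null_setsD2[OF null]] null_setsD1[OF null] by (simp add: measure_def)
qed

text \<open>Programs form a countable type, so this lets the candidates for \<open>Y\<close> be
  listed along the natural numbers.\<close>

lemma re_eq_domain:
  assumes "re Y"
  shows "\<exists>e. Y = {\<tau>. \<exists>y. computes (\<lambda>_. 0) e [list_encode \<tau>] y}"
proof -
  obtain e where e: "list_encode ` Y = {n. \<exists>y. computes (\<lambda>_. 0) e [n] y}"
    using assms unfolding re_def re_nat_def by blast
  have "\<tau> \<in> Y \<longleftrightarrow> list_encode \<tau> \<in> list_encode ` Y" for \<tau>
    using inj_list_encode by (auto dest: inj_onD)
  then show ?thesis
    unfolding e by blast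
qed

theorem theorem12:
  "\<exists>f :: nat \<Rightarrow> nat. uniformly_ae_dominating f \<and>
     \<not> (\<exists>Y :: nat list set. infinite Y \<and> re Y \<and> sigma1_dense_in Y f)"
proof -
  \<comment> \<open>Each \<open>n\<close> is decoded twice: as a program, whose domain is the set to
    defeat, and as a pair \<open>(e, k)\<close>, whose promise is to be added.\<close>
  let ?Y = "\<lambda>n. {\<tau>. \<exists>y. computes (\<lambda>_. 0) (from_nat n) [list_encode \<tau>] y}"
  let ?step = "\<lambda>n (\<sigma>, P) (\<rho>, Q). prefix \<sigma> \<rho> \<and> length \<sigma> < length \<rho> \<and> P \<subseteq> Q \<and>
    (\<forall>f. meets f \<rho> Q \<longrightarrow> \<not> sigma1_dense_in (?Y n) f) \<and>
    (case from_nat n of (e, k) \<Rightarrow> \<exists>N. (e, N, measure cantor_measure (total_oracles e) - 1 / Suc k) \<in> Q)"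
  have "\<exists>c. \<forall>n. (case c n of (\<sigma>, P) \<Rightarrow> finite P \<and> keeps \<sigma> P) \<and> ?step n (c n) (c (Suc n))"
  proof (rule dependent_nat_choice)
    show "\<exists>c. case c of (\<sigma>, P) \<Rightarrow> finite P \<and> keeps \<sigma> P"
      by (intro exI[of _ "([], {})"]) (simp add: keeps_def)
  next
    fix c :: "nat list \<times> (program \<times> nat \<times> real) set" and n
    assume c: "case c of (\<sigma>, P) \<Rightarrow> finite P \<and> keeps \<sigma> P"
    obtain \<sigma> P where [simp]: "c = (\<sigma>, P)"
      by (cases c)
    obtain e :: program and k :: nat where [simp]: "from_nat n = (e, k)"
      by (cases "from_nat n :: program \<times> nat")
    have "finite P" "keeps \<sigma> P"
      using c by auto
    from condition_step[OF this, of "?Y n" e k] obtain \<rho> Q where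
      "prefix \<sigma> \<rho> \<and> length \<sigma> < length \<rho> \<and> P \<subseteq> Q \<and> finite Q \<and> keeps \<rho> Q \<and>
      (\<forall>f. meets f \<rho> Q \<longrightarrow> \<not> sigma1_dense_in (?Y n) f) \<and>
      (\<exists>N. (e, N, measure cantor_measure (total_oracles e) - 1 / Suc k) \<in> Q)"
      by blast
    then show "\<exists>d. (case d of (\<sigma>, P) \<Rightarrow> finite P \<and> keeps \<sigma> P) \<and> ?step n c d"
      by (intro exI[of _ "(\<rho>, Q)"]) simp
  qed
  then obtain c where
    "\<forall>n. (case c n of (\<sigma>, P) \<Rightarrow> finite P \<and> keeps \<sigma> P) \<and> ?step n (c n) (c (Suc n))" ..
  then have c: "(case c n of (\<sigma>, P) \<Rightarrow> finite P \<and> keeps \<sigma> P) \<and> ?step n (c n) (c (Suc n))" for n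
    by (rule spec)
  define \<sigma> where "\<sigma> n = fst (c n)" for n
  define P where "P n = snd (c n)" for n
  have keeps: "keeps (\<sigma> n) (P n)"
    and step: "prefix (\<sigma> n) (\<sigma> (Suc n))" "length (\<sigma> n) < length (\<sigma> (Suc n))" "P n \<subseteq> P (Suc n)"
    and not_dense: "meets f (\<sigma> (Suc n)) (P (Suc n)) \<Longrightarrow> \<not> sigma1_dense_in (?Y n) f"
    and promise: "from_nat n = (e, k) \<Longrightarrow>
      \<exists>N. (e, N, measure cantor_measure (total_oracles e) - 1 / Suc k) \<in> P (Suc n)" for n f e k
    using c[of n] by (auto simp: \<sigma>_def P_def split: prod.splits)
  have prefix: "prefix (\<sigma> m) (\<sigma> n)" if "m \<le> n" for m n
    using that by (induction rule: dec_induct) (auto intro: prefix_order.trans step(1))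
  have P_mono: "P m \<subseteq> P n" if "m \<le> n" for m n
    using step(3) that by (rule lift_Suc_mono_le)
  have length: "n \<le> length (\<sigma> n)" for n
    by (induction n) (use step(2) in \<open>auto intro: le_less_trans Suc_leI\<close>)
  \<comment> \<open>The string \<open>\<sigma> (Suc n)\<close> is longer than \<open>n\<close>, so
    this entry exists, and the later strings extend it.\<close>
  define f where "f n = \<sigma> (Suc n) ! n" for n
  have nth: "\<sigma> n ! i = f i" if "i < length (\<sigma> n)" for n i
  proof -
    have "i < length (\<sigma> (Suc i))"
      using length[of "Suc i"] by simp
    then show ?thesis
      using that prefix[of n "Suc i"] prefix[of "Suc i" n] unfolding f_def
      by (cases n "Suc i" rule: le_cases) (auto simp: prefix_def nth_append)
  qed
  have init: "f \<restriction> length (\<sigma> n) = \<sigma> n" for n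
    by (rule nth_equalityI) (auto simp: restrict_to_def nth)
  have meets: "meets f (\<sigma> n) (P n)" for n
    unfolding meets_def
  proof (intro conjI allI)
    show "initial_segment (\<sigma> n) f"
      unfolding initial_segment_def using init[of n] by metis
    fix m
    \<comment> \<open>Stage \<open>max m n\<close> has a string of length at least \<open>m\<close>
      and retains all promises of stage \<open>n\<close>.\<close>
    have "prefix (f \<restriction> m) (\<sigma> (max m n))"
      using prefix_restrict_to[of m "length (\<sigma> (max m n))" f] length[of "max m n"] by (simp add: init)
    then show "keeps (f \<restriction> m) (P n)"
      by (rule keeps_prefix[OF keeps]) (rule P_mono, simp)
  qed
  have "uniformly_ae_dominating f"
  proof (rule uniformly_ae_dominatingI)
    fix e :: program and k :: nat
    \<comment> \<open>The stage numbered by the code of \<open>(e, k)\<close> makes the required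
      promise, which is therefore present from the following condition on.\<close>
    have "from_nat (to_nat (e, k)) = (e, k)"
      by simp
    from promise[OF this] obtain N where
      "(e, N, measure cantor_measure (total_oracles e) - 1 / Suc k) \<in> P (Suc (to_nat (e, k)))"
      by blast
    then show "\<exists>N. \<forall>n. measure cantor_measure (total_oracles e) - 1 / Suc k <
        measure cantor_measure (obeys e N (f \<restriction> n) \<inter> total_oracles e)"
      using meets[of "Suc (to_nat (e, k))"] keepsD unfolding meets_def by blast
  qed
  moreover have "\<not> sigma1_dense_in Y f" if re: "re Y" for Y
  proof -
    obtain e where "Y = {\<tau>. \<exists>y. computes (\<lambda>_. 0) e [list_encode \<tau>] y}"
      using re_eq_domain[OF re] by blast
    then have "Y = ?Y (to_nat e)"
      by simp
    then show ?thesis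
      using not_dense[OF meets, of "to_nat e"] by simp
  qed
  ultimately show ?thesis
    by blast
qed

end
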